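(* Suppose that the loss $L(\theta)$ is bounded from below by $L_{\inf}$ in some open subset of its domain, that $g$ is $C^1$ with respect to all variables, that the gradients of $g$ with respect to $\theta$ and $y$ are $L_\theta$- and $L_y$-Lipschitz, respectively, and that the second-order partial derivatives of $g$ with respect to $\theta$ exist. Let $\epsilon_p>0$ and suppose the approximate fixed points satisfy $\|(\tilde y_\theta(z)-z)+\nabla_y g_\theta(\tilde y_\theta(z))\|<\epsilon_p$ for all $\theta$ and $z$, and that $\int\|x\|^2\,d\mu(x)<\infty$ and $\int\|z\|^2\,d\nu(z)<\infty$. Suppose further that for some $0<V<1$, for all $\theta$ and all $z$, $$\|\tilde y_\theta(z)-y_\theta^*(z)\|<\epsilon\le\frac{V\,\|\nabla_\theta L(\theta)\|^2}{L_\theta\big(\sqrt{M_x}+\sqrt{M_z}\big)},$$ where $\epsilon$ does not depend on $z$ but may depend on $\theta$, and put $U=1-V$. Suppose the sequence of learning rates $\{\alpha_j\}_{j=0}^\infty$ is monotonically decreasing and satisfies $\sum_{j=0}^\infty\alpha_j=\infty$, $\sum_{j=0}^\infty\alpha_j^2<\infty$ and $0<\alpha_0\le\frac{UM_L}{L_\theta\tilde M}$. Then the SGD iteration $\theta_{j+1}=\theta_j-\alpha_j\tilde d_{\xi_j}(\theta_j)$, $j\ge0$, satisfies $$\liminf_{j\to\infty}\mathbb{E}\big[\|\nabla_\theta L(\theta_j)\|^2\big]=0 .$$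
   Context: $\mu,\nu$ are probability measures on $\mathbb{R}^d$. $g:\mathbb{R}^p\times\mathbb{R}^d\to\mathbb{R}$, $(\theta,y)\mapsto g_\theta(y)$, is a parameterized potential with $\theta\in\mathbb{R}^p$, convex in $y$ for each $\theta$. Its gradients with respect to $\theta$ and $y$ are regarded as functions of $(\theta,y)$. $\frac{\partial g_\theta}{\partial\theta}(y)$ is the partial gradient in $\theta$ at fixed $y$. For $z\in\mathbb{R}^d$, $y_\theta^*(z)$ is the unique minimizer of $y\mapsto\frac12\|y-z\|^2+g_\theta(y)$, and $\tilde y_\theta(z)$ (measurable) is an approximation of it. The loss is $$L(\theta)=\mathbb{E}_{x\sim\mu}[g_\theta(x)]-\mathbb{E}_{z\sim\nu}\Big[\tfrac12\|y_\theta^*(z)-z\|^2+g_\theta(y_\theta^*(z))\Big],$$ whose gradient is $\nabla_\theta L(\theta)=\mathbb{E}_{x\sim\mu}\big[\frac{\partial g_\theta}{\partial\theta}(x)\big]-\mathbb{E}_{z\sim\nu}\big[\frac{\partial g_\theta}{\partial\theta}(y_\theta^*(z))\big]$. Constants: $M_x,M_z\in(0,\infty)$ are such that for all $\theta$: $\mathbb{E}_{x\sim\mu}\big[\|\frac{\partial g_\theta}{\partial\theta}(x)\|^2\big]<M_x$, $\mathbb{E}_{z\sim\nu}\big[\|\frac{\partial g_\theta}{\partial\theta}(\tilde y_\theta(z))\|^2\big]<M_z$, $\mathbb{E}_{z\sim\nu}\big[\|\frac{\partial g_\theta}{\partial\theta}(y_\theta^*(z))\|^2\big]<M_z$; $\tilde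 M=M_x+M_z+2\sqrt{M_xM_z}$; and $M_L\in(0,\infty)$ is such that $\|\nabla_\theta L(\theta)\|^2\le M_L$ for all $\theta$. SGD: $\xi_0,\xi_1,\dots$ are independent random variables; $\xi_j$ consists of i.i.d. samples $x_1,\dots,x_B\sim\mu$ and $z_1,\dots,z_B\sim\nu$ ($B\ge1$), and $\tilde d_{\xi_j}(\theta)=\frac1B\sum_{i=1}^B\frac{\partial g_\theta}{\partial\theta}(x_i)-\frac1B\sum_{i=1}^B\frac{\partial g_\theta}{\partial\theta}(\tilde y_\theta(z_i))$. $\alpha_j>0$ are deterministic learning rates and $\theta_0$ is given. $\mathbb{E}[\cdot]$ is the total expectation over all $\xi_0,\xi_1,\dots$ *)

theory Defs
  imports "HOL-Probability.Probability"
begin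

definition grad :: "('a::real_inner \<Rightarrow> real) \<Rightarrow> 'a \<Rightarrow> 'a" where
  "grad f x = (THE D. GDERIV f x :> D)"

definition C1 :: "('a::real_normed_vector \<Rightarrow> real) \<Rightarrow> bool" where
  "C1 f \<longleftrightarrow> (\<exists>f' :: 'a \<Rightarrow> 'a \<Rightarrow>\<^sub>L real.
     (\<forall>x. (f has_derivative blinfun_apply (f' x)) (at x)) \<and> continuous_on UNIV f')"

text \<open>Below, a potential is a function \<open>g\<close> of the parameter \<open>\<theta>\<close> (first argument) and
  the point \<open>y\<close> (second argument).\<close>

definition grad_param :: "(real^'p \<Rightarrow> real^'d \<Rightarrow> real) \<Rightarrow> real^'p \<Rightarrow> real^'d \<Rightarrow> real^'p" where
  "grad_param g \<theta> y = grad (\<lambda>t. g t y) \<theta>"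

definition grad_point :: "(real^'p \<Rightarrow> real^'d \<Rightarrow> real) \<Rightarrow> real^'p \<Rightarrow> real^'d \<Rightarrow> real^'d" where
  "grad_point g \<theta> y = grad (g \<theta>) y"

text \<open>The \<open>j\<close>-th component of \<^const>\<open>grad_param\<close> is the partial derivative of \<open>g\<close> in
  \<open>\<theta>\<^sub>j\<close>; it has to be partially differentiable in every \<open>\<theta>\<^sub>i\<close>.\<close>

definition second_param_partials_exist :: "(real^'p \<Rightarrow> real^'d \<Rightarrow> real) \<Rightarrow> bool" where
  "second_param_partials_exist g \<longleftrightarrow>
     (\<forall>\<theta> y i j. (\<lambda>t::real. grad_param g (\<theta> + t *\<^sub>R axis i 1) y $ j) differentiable (at 0))"

definition exact_min :: "(real^'p \<Rightarrow> real^'d \<Rightarrow> real) \<Rightarrow> real^'p \<Rightarrow> real^'d \<Rightarrow> real^'d" where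
  "exact_min g \<theta> z =
     (THE y. is_arg_min (\<lambda>y. 1/2 * (norm (y - z))\<^sup>2 + g \<theta> y) (\<lambda>_. True) y)"

definition loss ::
  "(real^'d) measure \<Rightarrow> (real^'d) measure \<Rightarrow> (real^'p \<Rightarrow> real^'d \<Rightarrow> real) \<Rightarrow> real^'p \<Rightarrow> real" where
  "loss \<mu> \<nu> g \<theta> =
     (\<integral>x. g \<theta> x \<partial>\<mu>)
     - (\<integral>z. (1/2 * (norm (exact_min g \<theta> z - z))\<^sup>2 + g \<theta> (exact_min g \<theta> z)) \<partial>\<nu>)"

text \<open>A minibatch is a pair \<open>(x, z)\<close> of families indexed by \<open>{..<B}\<close>; the following is its
  law when all \<open>2 B\<close> samples are independent, the \<open>x i\<close> distributed as \<open>\<mu>\<close> and the \<open>z i\<close>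
  as \<open>\<nu>\<close>.\<close>

definition batch_law ::
  "nat \<Rightarrow> 'a measure \<Rightarrow> 'a measure \<Rightarrow> ((nat \<Rightarrow> 'a) \<times> (nat \<Rightarrow> 'a)) measure" where
  "batch_law B \<mu> \<nu> = (\<Pi>\<^sub>M i\<in>{..<B}. \<mu>) \<Otimes>\<^sub>M (\<Pi>\<^sub>M i\<in>{..<B}. \<nu>)"

definition stoch_grad ::
  "(real^'p \<Rightarrow> real^'d \<Rightarrow> real) \<Rightarrow> (real^'p \<Rightarrow> real^'d \<Rightarrow> real^'d) \<Rightarrow> nat
    \<Rightarrow> (nat \<Rightarrow> real^'d) \<times> (nat \<Rightarrow> real^'d) \<Rightarrow> real^'p \<Rightarrow> real^'p" where
  "stoch_grad g ytil B b \<theta> =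
     (1 / real B) *\<^sub>R (\<Sum>i<B. grad_param g \<theta> (fst b i))
     - (1 / real B) *\<^sub>R (\<Sum>i<B. grad_param g \<theta> (ytil \<theta> (snd b i)))"

primrec sgd ::
  "(real^'p \<Rightarrow> real^'d \<Rightarrow> real) \<Rightarrow> (real^'p \<Rightarrow> real^'d \<Rightarrow> real^'d) \<Rightarrow> nat \<Rightarrow> (nat \<Rightarrow> real)
    \<Rightarrow> (nat \<Rightarrow> 'w \<Rightarrow> (nat \<Rightarrow> real^'d) \<times> (nat \<Rightarrow> real^'d)) \<Rightarrow> real^'p \<Rightarrow> nat \<Rightarrow> 'w \<Rightarrow> real^'p" where
  "sgd g ytil B \<alpha> \<xi> \<theta>0 0 = (\<lambda>\<omega>. \<theta>0)"
| "sgd g ytil B \<alpha> \<xi> \<theta>0 (Suc j) = (\<lambda>\<omega>.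
     sgd g ytil B \<alpha> \<xi> \<theta>0 j \<omega>
     - \<alpha> j *\<^sub>R stoch_grad g ytil B (\<xi> j \<omega>) (sgd g ytil B \<alpha> \<xi> \<theta>0 j \<omega>))"

end

theory Submission
  imports Defs
begin

text \<open>By the envelope principle \<open>loss\<close> has the gradient \<open>G \<theta> = E[\<partial>\<^sub>\<theta> g(x)] - E[\<partial>\<^sub>\<theta> g(y*(z))]\<close>, and
  it satisfies a descent inequality with a quadratic error term because the minimizer \<open>y*\<close> is
  Lipschitz in \<open>\<theta>\<close>. Replacing \<open>y*\<close> by the approximation biases the expected step by at most
  \<open>Lth * eps \<theta>\<close>, hence its inner product with \<open>G \<theta>\<close> is still at least \<open>(1 - V) |G \<theta>|\<^sup>2\<close>. As the
  loss is bounded below on the whole parameter space (the minimal value defining the envelope at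
  \<open>z\<close> is at most \<open>|x - z|\<^sup>2 / 2 + g \<theta> x\<close>), summing the expected descent bounds
  \<open>\<Sum>j. \<alpha> j * E |G (\<theta> j)|\<^sup>2\<close>, whereas \<open>\<Sum>j. \<alpha> j\<close> diverges.\<close>

section \<open>Gradients\<close>

lemma GDERIV_grad:
  fixes f :: "'a::real_inner \<Rightarrow> real"
  assumes "GDERIV f x :> D"
  shows "grad f x = D"
  unfolding grad_def
proof (rule the_equality)
  fix E assume "GDERIV f x :> E"
  then have "(\<lambda>h. inner h E) = (\<lambda>h. inner h D)"
    using assms unfolding gderiv_def by (rule has_derivative_unique)
  then have "inner h (E - D) = 0" for h
    by (metis inner_diff_right right_minus_eq)
  then show "E = D"
    by (metis inner_eq_zero_iff right_minus_eq)
qed (rule assms)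

text \<open>In finite dimension the derivative, being linear, is represented by the vector of its
  values on \<open>Basis\<close>. So the description in \<open>grad\<close> denotes the true
  gradient wherever a derivative exists.\<close>

lemma has_derivative_imp_GDERIV_grad:
  fixes f :: "'a::euclidean_space \<Rightarrow> real"
  assumes "(f has_derivative f') (at x)"
  shows "GDERIV f x :> grad f x"
proof -
  interpret linear f'
    using assms by (rule has_derivative_linear)
  have "f' = (\<lambda>h. inner h (\<Sum>b\<in>Basis. f' b *\<^sub>R b))"
  proof
    fix h :: 'a
    have "f' h = f' (\<Sum>b\<in>Basis. inner h b *\<^sub>R b)"
      by (simp add: euclidean_representation)
    then show "f' h = inner h (\<Sum>b\<in>Basis. f' b *\<^sub>R b)"
      by (simp add: sum scale inner_sum_right mult.commute)
  qed
  then have "GDERIV f x :> (\<Sum>b\<in>Basis. f' b *\<^sub>R b)"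
    using assms unfolding gderiv_def by simp
  with GDERIV_grad show ?thesis by metis
qed

section \<open>First-order estimates by restriction to lines\<close>

lemma GDERIV_line:
  fixes f :: "'a::real_inner \<Rightarrow> real"
  assumes "GDERIV f (x + t *\<^sub>R h) :> D"
  shows "((\<lambda>t. f (x + t *\<^sub>R h)) has_real_derivative inner h D) (at t)"
proof -
  have "((\<lambda>t. x + t *\<^sub>R h) has_derivative (\<lambda>s. s *\<^sub>R h)) (at t)"
    by (auto intro!: derivative_eq_intros)
  from has_derivative_compose[OF this assms[unfolded gderiv_def]]
  show ?thesis
    by (simp add: has_field_derivative_def mult_commute_abs)
qed

text \<open>The restriction of \<open>f\<close> to the line through \<open>x\<close> and
  \<open>y\<close> is convex, so the one-dimensional tangent inequality at parameter 0, evaluated at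
  parameter 1, gives the claim.\<close>

lemma convex_on_GDERIV_below:
  fixes f :: "'a::real_inner \<Rightarrow> real"
  assumes "convex_on UNIV f" "GDERIV f x :> D"
  shows "f x + inner (y - x) D \<le> f y"
proof -
  define \<phi> where "\<phi> t = f (x + t *\<^sub>R (y - x))" for t :: real
  have "convex_on UNIV \<phi>"
  proof (rule convex_onI)
    fix t a b :: real assume t: "0 < t" "t < 1"
    have "x + ((1 - t) * a + t * b) *\<^sub>R (y - x)
        = (1 - t) *\<^sub>R (x + a *\<^sub>R (y - x)) + t *\<^sub>R (x + b *\<^sub>R (y - x))"
      by (simp add: algebra_simps)
    then show "\<phi> ((1 - t) *\<^sub>R a + t *\<^sub>R b) \<le> (1 - t) * \<phi> a + t * \<phi> b"
      using convex_onD[OF assms(1), of t] t by (simp add: \<phi>_def)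
  qed simp
  moreover have "(\<phi> has_real_derivative inner (y - x) D) (at 0)"
    unfolding \<phi>_def using assms(2) by (intro GDERIV_line) simp
  ultimately have "inner (y - x) D * (1 - 0) \<le> \<phi> 1 - \<phi> 0"
    by (intro convex_on_imp_above_tangent[of UNIV]) auto
  then show ?thesis by (simp add: \<phi>_def)
qed

text \<open>By the mean value theorem the increment equals the derivative at an intermediate point,
  whose gradient differs from \<open>D x\<close> by at most \<open>C * norm h\<close>. This yields
  the factor \<open>C\<close> instead of the sharp \<open>C / 2\<close>; later arguments use only
  that the error is quadratic.\<close>

lemma lipschitz_gradient_expansion:
  fixes f :: "'a::real_inner \<Rightarrow> real"
  assumes D: "\<And>x. GDERIV f x :> D x"
    and lip: "\<And>x y. norm (D x - D y) \<le> C * norm (x - y)"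
  shows "\<bar>f (x + h) - f x - inner h (D x)\<bar> \<le> C * (norm h)\<^sup>2"
proof -
  have "\<exists>t>0. t < 1 \<and> f (x + 1 *\<^sub>R h) - f (x + 0 *\<^sub>R h) = (1 - 0) * inner h (D (x + t *\<^sub>R h))"
    by (rule MVT2) (auto intro: GDERIV_line D)
  then obtain t where t: "0 < t" "t < 1" "f (x + h) - f x = inner h (D (x + t *\<^sub>R h))"
    by auto
  have C: "0 \<le> C * norm h"
    using order_trans[OF norm_ge_zero lip[of "x + h" x]] by simp
  have "\<bar>f (x + h) - f x - inner h (D x)\<bar> = \<bar>inner h (D (x + t *\<^sub>R h) - D x)\<bar>"
    by (simp add: t inner_diff_right)
  also have "\<dots> \<le> norm h * (C * norm (t *\<^sub>R h))"
    using lip[of "x + t *\<^sub>R h" x]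
    by (intro order_trans[OF Cauchy_Schwarz_ineq2] mult_left_mono) auto
  also have "\<dots> = t * (norm h * (C * norm h))"
    using t by simp
  also have "\<dots> \<le> 1 * (norm h * (C * norm h))"
    using t C by (intro mult_right_mono) auto
  finally show ?thesis by (simp add: power2_eq_square mult_ac)
qed

text \<open>A quadratic remainder is \<open>o(norm h)\<close>. This is how the loss is shown to be
  differentiable, without differentiating under the integral.\<close>

lemma GDERIV_quadratic_remainder:
  fixes f :: "'a::real_inner \<Rightarrow> real"
  assumes "\<And>h. \<bar>f (x + h) - f x - inner h D\<bar> \<le> C * (norm h)\<^sup>2"
  shows "GDERIV f x :> D"
  unfolding gderiv_def has_derivative_at
proof (intro conjI)
  show "bounded_linear (\<lambda>h. inner h D)" by (rule bounded_linear_inner_left)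
  show "(\<lambda>h. norm (f (x + h) - f x - inner h D) / norm h) \<midarrow>0\<rightarrow> 0"
  proof (rule Lim_null_comparison)
    show "\<forall>\<^sub>F h in at 0. norm (norm (f (x + h) - f x - inner h D) / norm h) \<le> C * norm h"
    proof (rule always_eventually, rule allI)
      fix h
      show "norm (norm (f (x + h) - f x - inner h D) / norm h) \<le> C * norm h"
        using assms[of h] by (cases "h = 0") (auto simp: pos_divide_le_eq power2_eq_square)
    qed
    show "(\<lambda>h. C * norm h) \<midarrow>0\<rightarrow> 0"
      by (auto intro!: tendsto_eq_intros)
  qed
qed

section \<open>Minimizer and envelope of a Lipschitz-smooth potential\<close>

locale lipschitz_potential =
  fixes g :: "real^'p \<Rightarrow> real^'d \<Rightarrow> real" and Lth Ly :: real
  assumes convex: "convex_on UNIV (g \<theta>)"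
    and C1: "C1 (\<lambda>(\<theta>, y). g \<theta> y)"
    and lip_param: "Lth-lipschitz_on UNIV (\<lambda>(\<theta>, y). grad_param g \<theta> y)"
    and lip_point: "Ly-lipschitz_on UNIV (\<lambda>(\<theta>, y). grad_point g \<theta> y)"
begin

lemma Lth_nonneg: "0 \<le> Lth" and Ly_nonneg: "0 \<le> Ly"
  using lip_param lip_point by (auto simp: lipschitz_on_def)

lemma grad_param_lipschitz:
  "norm (grad_param g \<theta> y - grad_param g \<theta>' y) \<le> Lth * norm (\<theta> - \<theta>')"
  "norm (grad_param g \<theta> y - grad_param g \<theta> y') \<le> Lth * norm (y - y')"
  using lipschitz_onD[OF lip_param, of "(\<theta>, y)" "(\<theta>', y)"]
    lipschitz_onD[OF lip_param, of "(\<theta>, y)" "(\<theta>, y')"]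
  by (simp_all add: dist_Pair_Pair dist_norm)

lemma grad_point_lipschitz:
  "norm (grad_point g \<theta> y - grad_point g \<theta>' y) \<le> Ly * norm (\<theta> - \<theta>')"
  "norm (grad_point g \<theta> y - grad_point g \<theta> y') \<le> Ly * norm (y - y')"
  using lipschitz_onD[OF lip_point, of "(\<theta>, y)" "(\<theta>', y)"]
    lipschitz_onD[OF lip_point, of "(\<theta>, y)" "(\<theta>, y')"]
  by (simp_all add: dist_Pair_Pair dist_norm)

lemma GDERIV_param: "GDERIV (\<lambda>t. g t y) \<theta> :> grad_param g \<theta> y"
proof -
  obtain f' where f': "((\<lambda>(\<theta>, y). g \<theta> y) has_derivative f') (at (\<theta>, y))"
    using C1 unfolding C1_def by blast
  have "((\<lambda>t. (t, y)) has_derivative (\<lambda>h. (h, 0))) (at \<theta>)"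
    by (auto intro!: derivative_eq_intros)
  from has_derivative_compose[OF this f'] show ?thesis
    unfolding grad_param_def by (auto intro: has_derivative_imp_GDERIV_grad)
qed

lemma GDERIV_point: "GDERIV (g \<theta>) y :> grad_point g \<theta> y"
proof -
  obtain f' where f': "((\<lambda>(\<theta>, y). g \<theta> y) has_derivative f') (at (\<theta>, y))"
    using C1 unfolding C1_def by blast
  have "((\<lambda>y. (\<theta>, y)) has_derivative (\<lambda>h. (0, h))) (at y)"
    by (auto intro!: derivative_eq_intros)
  from has_derivative_compose[OF this f'] show ?thesis
    unfolding grad_point_def by (auto intro: has_derivative_imp_GDERIV_grad)
qed

lemma continuous_on_grad_param: "continuous_on UNIV (\<lambda>(\<theta>, y). grad_param g \<theta> y)"
  using lip_param by (rule lipschitz_on_continuous_on)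

lemma continuous_on_potential_point: "continuous_on UNIV (g \<theta>)"
  by (rule continuous_at_imp_continuous_on)
    (use GDERIV_point has_derivative_continuous in \<open>unfold gderiv_def, blast\<close>)

lemma measurable_potential [measurable]:
  assumes "f \<in> borel_measurable N"
  shows "(\<lambda>x. g \<theta> (f x)) \<in> borel_measurable N"
  using measurable_compose[OF assms borel_measurable_continuous_onI[OF continuous_on_potential_point]] .

lemma measurable_grad_param [measurable]:
  assumes "f \<in> borel_measurable N" "h \<in> borel_measurable N"
  shows "(\<lambda>x. grad_param g (f x) (h x)) \<in> borel_measurable N"
  by (rule borel_measurable_continuous_Pair[OF assms])
    (use continuous_on_grad_param in \<open>simp only: case_prod_unfold\<close>)

section \<open>Convexity inequalities and growth bounds\<close>

lemma grad_point_above: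
  "g \<theta> y + inner (y' - y) (grad_point g \<theta> y) \<le> g \<theta> y'"
  by (rule convex_on_GDERIV_below[OF convex GDERIV_point])

lemma grad_point_monotone:
  "0 \<le> inner (y - y') (grad_point g \<theta> y - grad_point g \<theta> y')"
  using grad_point_above[of \<theta> y y'] grad_point_above[of \<theta> y' y]
  by (simp add: inner_diff_right inner_diff_left)

lemma param_expansion:
  "\<bar>g (\<theta> + h) y - g \<theta> y - inner h (grad_param g \<theta> y)\<bar> \<le> Lth * (norm h)\<^sup>2"
  by (rule lipschitz_gradient_expansion[OF GDERIV_param grad_param_lipschitz(1)])

text \<open>A Lipschitz gradient in \<open>y\<close> forces at most quadratic growth, so a finite
  second moment makes the potential integrable.\<close>

lemma abs_potential_le:
  "\<bar>g \<theta> y\<bar> \<le> (\<bar>g \<theta> 0\<bar> + norm (grad_point g \<theta> 0)) + (norm (grad_point g \<theta> 0) + Ly) * (norm y)\<^sup>2"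
proof -
  have "\<bar>g \<theta> (0 + y) - g \<theta> 0 - inner y (grad_point g \<theta> 0)\<bar> \<le> Ly * (norm y)\<^sup>2"
    by (rule lipschitz_gradient_expansion[OF GDERIV_point grad_point_lipschitz(2)])
  moreover have "\<bar>inner y (grad_point g \<theta> 0)\<bar> \<le> (1 + (norm y)\<^sup>2) * norm (grad_point g \<theta> 0)"
  proof (rule order_trans[OF Cauchy_Schwarz_ineq2 mult_right_mono])
    have "0 \<le> (norm y - 1/2)\<^sup>2" by simp
    then show "norm y \<le> 1 + (norm y)\<^sup>2" by (simp add: power2_eq_square algebra_simps)
  qed simp
  ultimately show ?thesis by (simp add: algebra_simps)
qed

lemma norm_grad_param_square_le:
  "(norm (grad_param g \<theta> y))\<^sup>2 \<le> 2 * (norm (grad_param g \<theta> 0))\<^sup>2 + 2 * Lth\<^sup>2 * (norm y)\<^sup>2"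
proof -
  have "norm (grad_param g \<theta> y) \<le> norm (grad_param g \<theta> 0) + Lth * norm y"
    using grad_param_lipschitz(2)[of \<theta> y 0] norm_triangle_sub[of "grad_param g \<theta> y" "grad_param g \<theta> 0"]
    by simp
  then have "(norm (grad_param g \<theta> y))\<^sup>2 \<le> (norm (grad_param g \<theta> 0) + Lth * norm y)\<^sup>2"
    by (intro power_mono) auto
  also have "\<dots> \<le> 2 * (norm (grad_param g \<theta> 0))\<^sup>2 + 2 * (Lth * norm y)\<^sup>2"
    using sum_squares_bound[of "norm (grad_param g \<theta> 0)" "Lth * norm y"]
    by (simp add: power2_sum)
  finally show ?thesis by (simp add: power_mult_distrib)
qed

text \<open>Convexity makes the objective \<open>F\<close> coercive, so a minimizer exists by
  compactness. Minimizers satisfy \<open>grad_point g \<theta> y = z - y\<close>, and monotonicity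
  of the gradient allows only one solution. Hence the description in \<open>exact_min\<close>
  denotes the minimizer.\<close>

lemma exact_min_is_arg_min:
  "is_arg_min (\<lambda>y. 1/2 * (norm (y - z))\<^sup>2 + g \<theta> y) (\<lambda>_. True) (exact_min g \<theta> z)"
  and exact_min_stationary: "grad_point g \<theta> (exact_min g \<theta> z) = z - exact_min g \<theta> z"
proof -
  define F where "F y = 1/2 * (norm (y - z))\<^sup>2 + g \<theta> y" for y
  have stat: "grad_point g \<theta> y = z - y" if "is_arg_min F (\<lambda>_. True) y" for y
  proof -
    have "(F has_derivative (\<lambda>h. inner h (y - z + grad_point g \<theta> y))) (at y)"
      unfolding F_def power2_norm_eq_inner
      using GDERIV_point[of \<theta> y, unfolded gderiv_def]
      by (auto intro!: derivative_eq_intros simp: inner_commute inner_add_right inner_add_left)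
    then have "(\<lambda>h. inner h (y - z + grad_point g \<theta> y)) = (\<lambda>h. 0)"
      by (rule differential_zero_maxmin[of y UNIV, rotated 2])
        (use that in \<open>auto simp: is_arg_min_linorder\<close>)
    then have "y - z + grad_point g \<theta> y = 0" by (metis inner_eq_zero_iff)
    then show ?thesis by (metis add_eq_0_iff minus_diff_eq)
  qed
  have unique: "y = y'" if "is_arg_min F (\<lambda>_. True) y" "is_arg_min F (\<lambda>_. True) y'" for y y'
  proof -
    have "y - y' = - (grad_point g \<theta> y - grad_point g \<theta> y')"
      by (simp add: stat[OF that(1)] stat[OF that(2)])
    then have "inner (y - y') (y - y') \<le> 0"
      using grad_point_monotone[of y y' \<theta>] by (metis inner_minus_right neg_le_0_iff_le)
    then show ?thesis by (metis inner_ge_zero inner_eq_zero_iff order_antisym right_minus_eq)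
  qed
  \<comment> \<open>The tangent of \<open>g \<theta>\<close> at \<open>z\<close> gives
    \<open>F w - F z \<ge> d * (d / 2 - norm (grad_point g \<theta> z))\<close> with
    \<open>d = norm (w - z)\<close>, which is nonnegative once \<open>d\<close> is at least
    \<open>r\<close>. So minimizing over this ball suffices.\<close>
  define r where "r = 2 * norm (grad_point g \<theta> z)"
  have "continuous_on (cball z r) F"
    unfolding F_def
    by (intro continuous_intros continuous_on_subset[OF continuous_on_potential_point]) auto
  then obtain y where y: "y \<in> cball z r" "\<And>w. w \<in> cball z r \<Longrightarrow> F y \<le> F w"
    using continuous_attains_inf[of "cball z r" F] by (auto simp: r_def)
  have "F y \<le> F w" for w
  proof (cases "w \<in> cball z r")
    case False
    then have "norm (w - z) * r \<le> norm (w - z) * norm (w - z)"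
      by (intro mult_left_mono) (auto simp: dist_norm norm_minus_commute)
    moreover have "- (norm (w - z) * norm (grad_point g \<theta> z)) \<le> inner (w - z) (grad_point g \<theta> z)"
      using Cauchy_Schwarz_ineq2[of "w - z" "grad_point g \<theta> z"] by linarith
    ultimately have "F z \<le> F w"
      using grad_point_above[of \<theta> z w]
      by (simp add: F_def r_def power2_eq_square)
    moreover have "F y \<le> F z" using y(2)[of z] by (simp add: r_def)
    ultimately show ?thesis by linarith
  qed (use y in auto)
  then have min: "is_arg_min F (\<lambda>_. True) y"
    by (simp add: is_arg_min_linorder)
  have "exact_min g \<theta> z = y"
    unfolding exact_min_def F_def[symmetric]
    by (rule the_equality) (use min unique in auto)
  with min show "is_arg_min (\<lambda>y. 1/2 * (norm (y - z))\<^sup>2 + g \<theta> y) (\<lambda>_. True) (exact_min g \<theta> z)"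
    "grad_point g \<theta> (exact_min g \<theta> z) = z - exact_min g \<theta> z"
    using stat unfolding F_def by auto
qed

section \<open>The Moreau envelope of the potential and its dependence on the parameter\<close>

definition env :: "real^'p \<Rightarrow> real^'d \<Rightarrow> real" where
  "env \<theta> z = 1/2 * (norm (exact_min g \<theta> z - z))\<^sup>2 + g \<theta> (exact_min g \<theta> z)"

lemma env_le: "env \<theta> z \<le> 1/2 * (norm (y - z))\<^sup>2 + g \<theta> y"
  using exact_min_is_arg_min[of z \<theta>] by (simp add: env_def is_arg_min_linorder)

text \<open>Subtract the two stationarity equations and pair the result with the difference of the
  minimizers: the monotone part has a favourable sign and drops out. What remains is the shift of
  \<open>z\<close> and the change of the gradient caused by the parameter.\<close>

lemma exact_min_lipschitz:
  "norm (exact_min g \<theta> z - exact_min g \<theta>' z') \<le> norm (z - z') + Ly * norm (\<theta> - \<theta>')"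
proof -
  define y y' where "y = exact_min g \<theta> z" and "y' = exact_min g \<theta>' z'"
  \<comment> \<open>The point is frozen at \<open>y'\<close> here, so that \<open>e\<close> sees
    only the changes of \<open>z\<close> and \<theta>; the rest is a gradient difference at the
    fixed parameter \<theta>, to which monotonicity applies.\<close>
  define e where "e = (z - z') - (grad_point g \<theta> y' - grad_point g \<theta>' y')"
  have "y - y' = e - (grad_point g \<theta> y - grad_point g \<theta> y')"
    by (simp add: y_def y'_def e_def exact_min_stationary)
  then have "inner (y - y') (y - y') = inner (y - y') e - inner (y - y') (grad_point g \<theta> y - grad_point g \<theta> y')"
    by (metis inner_diff_right)
  also have "\<dots> \<le> norm (y - y') * norm e"
    using grad_point_monotone[of y y' \<theta>] norm_cauchy_schwarz[of "y - y'" e] by linarith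
  finally have "norm (y - y') * norm (y - y') \<le> norm (y - y') * norm e"
    by (simp add: dot_square_norm power2_eq_square)
  then have "norm (y - y') \<le> norm e"
    by (cases "norm (y - y') = 0") auto
  also have "\<dots> \<le> norm (z - z') + Ly * norm (\<theta> - \<theta>')"
    unfolding e_def by (rule order_trans[OF norm_triangle_ineq4])
      (use grad_point_lipschitz(1) in auto)
  finally show ?thesis by (simp add: y_def y'_def)
qed

text \<open>Joint measurability comes from joint Lipschitz continuity. It is needed because
  \<open>G\<close>, an integral over \<open>z\<close> depending on \<theta>, is later evaluated at
  random parameters.\<close>

lemma measurable_exact_min [measurable]:
  assumes "f \<in> borel_measurable N" "h \<in> borel_measurable N"
  shows "(\<lambda>x. exact_min g (f x) (h x)) \<in> borel_measurable N"
proof (rule borel_measurable_continuous_Pair[OF assms])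
  have "(1 + Ly)-lipschitz_on UNIV (\<lambda>p. exact_min g (fst p) (snd p))"
  proof (rule lipschitz_onI)
    fix p q :: "(real^'p) \<times> (real^'d)"
    have "Ly * dist (fst p) (fst q) \<le> Ly * dist p q"
      using Ly_nonneg by (intro mult_left_mono dist_fst_le)
    then show "dist (exact_min g (fst p) (snd p)) (exact_min g (fst q) (snd q)) \<le> (1 + Ly) * dist p q"
      using exact_min_lipschitz[of "fst p" "snd p" "fst q" "snd q"] dist_snd_le[of p q]
      by (simp add: dist_norm algebra_simps)
  qed (use Ly_nonneg in simp)
  then show "continuous_on UNIV (\<lambda>p. exact_min g (fst p) (snd p))"
    by (rule lipschitz_on_continuous_on)
qed

text \<open>Comparing the two minimal values at each other's minimizer bounds the increment of the
  envelope from both sides without differentiating the minimizer in \<open>\<theta>\<close>.\<close>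

lemma env_expansion:
  "\<bar>env (\<theta> + h) z - env \<theta> z - inner h (grad_param g \<theta> (exact_min g \<theta> z))\<bar>
    \<le> (Lth + Lth * Ly) * (norm h)\<^sup>2"
proof -
  define y y' where "y = exact_min g \<theta> z" and "y' = exact_min g (\<theta> + h) z"
  have "env (\<theta> + h) z - env \<theta> z \<le> g (\<theta> + h) y - g \<theta> y"
    using env_le[of "\<theta> + h" z y] by (simp add: env_def[of \<theta>] y_def)
  then have up: "env (\<theta> + h) z - env \<theta> z \<le> inner h (grad_param g \<theta> y) + Lth * (norm h)\<^sup>2"
    using param_expansion[of \<theta> h y] by linarith
  have "g (\<theta> + h) y' - g \<theta> y' \<le> env (\<theta> + h) z - env \<theta> z"
    using env_le[of \<theta> z y'] by (simp add: env_def[of "\<theta> + h"] y'_def)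
  then have "inner h (grad_param g \<theta> y') - Lth * (norm h)\<^sup>2 \<le> env (\<theta> + h) z - env \<theta> z"
    using param_expansion[of \<theta> h y'] by linarith
  \<comment> \<open>The lower bound carries the gradient at the new minimizer \<open>y'\<close>.
    Moving it to \<open>y\<close> costs \<open>Lth\<close> times the displacement
    \<open>Ly * norm h\<close> of the minimizer, which is the source of the term
    \<open>Lth * Ly\<close>.\<close>
  moreover have "inner h (grad_param g \<theta> y - grad_param g \<theta> y') \<le> norm h * (Lth * (Ly * norm h))"
  proof (rule order_trans[OF norm_cauchy_schwarz mult_left_mono])
    have "norm (y - y') \<le> Ly * norm h"
      using exact_min_lipschitz[of \<theta> z "\<theta> + h" z] by (simp add: y_def y'_def)
    then show "norm (grad_param g \<theta> y - grad_param g \<theta> y') \<le> Lth * (Ly * norm h)"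
      using Lth_nonneg
      by (intro order_trans[OF grad_param_lipschitz(2)] mult_left_mono)
  qed simp
  ultimately have
    "inner h (grad_param g \<theta> y) - (Lth + Lth * Ly) * (norm h)\<^sup>2 \<le> env (\<theta> + h) z - env \<theta> z"
    by (simp add: inner_diff_right algebra_simps power2_eq_square)
  moreover have "0 \<le> Lth * Ly * (norm h)\<^sup>2"
    using Lth_nonneg Ly_nonneg by simp
  ultimately show ?thesis
    using up unfolding y_def by (simp add: algebra_simps abs_le_iff)
qed

end

section \<open>The gradient of the loss\<close>

lemma norm_diff_square_le:
  fixes a b :: "'a::real_inner"
  shows "(norm (a - b))\<^sup>2 \<le> 2 * (norm a)\<^sup>2 + 2 * (norm b)\<^sup>2"
proof -
  have "0 \<le> (norm (a + b))\<^sup>2" by simp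
  then show ?thesis
    by (simp add: power2_norm_eq_inner inner_simps inner_commute)
qed

lemma integrable_dominated:
  fixes f h :: "'a \<Rightarrow> real"
  assumes "integrable M h" "\<And>x. \<bar>f x\<bar> \<le> h x" "f \<in> borel_measurable M"
  shows "integrable M f"
  using assms(1,3)
proof (rule Bochner_Integration.integrable_bound)
  show "AE x in M. norm (f x) \<le> norm (h x)"
    using order_trans[OF assms(2) abs_ge_self] by simp
qed

lemma (in finite_measure) integrable_if_square_integrable:
  fixes f :: "'a \<Rightarrow> 'b::{banach, second_countable_topology}"
  assumes "f \<in> borel_measurable M" "integrable M (\<lambda>x. (norm (f x))\<^sup>2)"
  shows "integrable M f"
proof (rule Bochner_Integration.integrable_bound)
  show "integrable M (\<lambda>x. 1 + (norm (f x))\<^sup>2)" using assms by simp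
  have "norm (f x) \<le> norm (1 + (norm (f x))\<^sup>2)" for x
  proof -
    have "0 \<le> (norm (f x) - 1/2)\<^sup>2" by simp
    then show ?thesis by (simp add: power2_eq_square algebra_simps)
  qed
  then show "AE x in M. norm (f x) \<le> norm (1 + (norm (f x))\<^sup>2)" by simp
qed (rule assms)

text \<open>Nonnegativity of the variance of \<open>norm (f x)\<close> bounds the square of its mean
  by its second moment.\<close>

lemma (in prob_space) norm_expectation_le_sqrt:
  fixes f :: "'a \<Rightarrow> 'b::{banach, second_countable_topology}"
  assumes "f \<in> borel_measurable M" "integrable M (\<lambda>x. (norm (f x))\<^sup>2)"
  shows "norm (\<integral>x. f x \<partial>M) \<le> sqrt (\<integral>x. (norm (f x))\<^sup>2 \<partial>M)"
proof -
  have "integrable M (\<lambda>x. norm (f x))"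
    by (rule integrable_norm[OF integrable_if_square_integrable[OF assms]])
  then have "(\<integral>x. norm (f x) \<partial>M)\<^sup>2 \<le> (\<integral>x. (norm (f x))\<^sup>2 \<partial>M)"
    using variance_positive[of "\<lambda>x. norm (f x)"] variance_eq[OF _ assms(2)] by linarith
  then have "(\<integral>x. norm (f x) \<partial>M) \<le> sqrt (\<integral>x. (norm (f x))\<^sup>2 \<partial>M)"
    by (rule real_le_rsqrt)
  then show ?thesis
    using integral_norm_bound[of M f] by linarith
qed

lemma (in prob_space) norm_expectation_le_const:
  fixes f :: "'a \<Rightarrow> real"
  assumes "integrable M f" "\<And>x. \<bar>f x\<bar> \<le> c"
  shows "\<bar>\<integral>x. f x \<partial>M\<bar> \<le> c"
proof -
  have "\<bar>\<integral>x. f x \<partial>M\<bar> \<le> (\<integral>x. \<bar>f x\<bar> \<partial>M)"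
    using integral_norm_bound[of M f] by simp
  also have "\<dots> \<le> c"
    using assms by (intro integral_le_const) auto
  finally show ?thesis .
qed

context lipschitz_potential
begin

text \<open>The growth bounds serve as integrable majorants. The map \<open>u\<close> is kept
  general so as to cover the identity under \<mu> as well as the exact and the approximate minimizer
  under \<nu>.\<close>

lemma
  assumes "prob_space N" and u [measurable]: "u \<in> borel_measurable N"
    and sq: "integrable N (\<lambda>z. (norm (u z))\<^sup>2)"
  shows integrable_potential: "integrable N (\<lambda>z. g \<theta> (u z))"
    and integrable_grad_param_square: "integrable N (\<lambda>z. (norm (grad_param g \<theta> (u z)))\<^sup>2)"
    and integrable_grad_param: "integrable N (\<lambda>z. grad_param g \<theta> (u z))"
proof -
  interpret N: prob_space N by fact
  show "integrable N (\<lambda>z. g \<theta> (u z))"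
  proof (rule integrable_dominated)
    let ?b = "\<lambda>z. (\<bar>g \<theta> 0\<bar> + norm (grad_point g \<theta> 0)) + (norm (grad_point g \<theta> 0) + Ly) * (norm (u z))\<^sup>2"
    show "integrable N ?b" using sq by simp
    show "\<bar>g \<theta> (u z)\<bar> \<le> ?b z" for z
      by (rule abs_potential_le)
  qed measurable
  show *: "integrable N (\<lambda>z. (norm (grad_param g \<theta> (u z)))\<^sup>2)"
  proof (rule integrable_dominated)
    let ?b = "\<lambda>z. 2 * (norm (grad_param g \<theta> 0))\<^sup>2 + 2 * Lth\<^sup>2 * (norm (u z))\<^sup>2"
    show "integrable N ?b" using sq by simp
    show "\<bar>(norm (grad_param g \<theta> (u z)))\<^sup>2\<bar> \<le> ?b z" for z
      using norm_grad_param_square_le by simp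
  qed measurable
  show "integrable N (\<lambda>z. grad_param g \<theta> (u z))"
    by (rule N.integrable_if_square_integrable) (use * in measurable)
qed

end

locale lipschitz_dual_loss = lipschitz_potential g Lth Ly
  for g :: "real^'p \<Rightarrow> real^'d \<Rightarrow> real" and Lth Ly :: real +
  fixes \<mu> \<nu> :: "(real^'d) measure"
  assumes prob_\<mu>: "prob_space \<mu>" and sets_\<mu> [measurable_cong]: "sets \<mu> = sets borel"
    and prob_\<nu>: "prob_space \<nu>" and sets_\<nu> [measurable_cong]: "sets \<nu> = sets borel"
    and moment_\<mu>: "integrable \<mu> (\<lambda>x. (norm x)\<^sup>2)"
    and moment_\<nu>: "integrable \<nu> (\<lambda>z. (norm z)\<^sup>2)"
begin

sublocale \<mu>: prob_space \<mu> by (rule prob_\<mu>)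
sublocale \<nu>: prob_space \<nu> by (rule prob_\<nu>)

lemma moment_exact_min: "integrable \<nu> (\<lambda>z. (norm (exact_min g \<theta> z))\<^sup>2)"
proof (rule integrable_dominated)
  let ?b = "\<lambda>z. 2 * (norm z)\<^sup>2 + 2 * (norm (exact_min g \<theta> 0))\<^sup>2"
  show "integrable \<nu> ?b" using moment_\<nu> by simp
  show "\<bar>(norm (exact_min g \<theta> z))\<^sup>2\<bar> \<le> ?b z" for z
  proof -
    have "norm (exact_min g \<theta> z) \<le> norm z + norm (exact_min g \<theta> 0)"
      using exact_min_lipschitz[of \<theta> z \<theta> 0] norm_triangle_sub[of "exact_min g \<theta> z" "exact_min g \<theta> 0"]
      by simp
    then have "(norm (exact_min g \<theta> z))\<^sup>2 \<le> (norm z + norm (exact_min g \<theta> 0))\<^sup>2"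
      by (intro power_mono) auto
    then show ?thesis
      using sum_squares_bound[of "norm z" "norm (exact_min g \<theta> 0)"] by (simp add: power2_sum)
  qed
qed measurable

lemmas integrable_\<mu> = integrable_potential[OF prob_\<mu> _ moment_\<mu>]
  integrable_grad_param_square[OF prob_\<mu> _ moment_\<mu>]
  integrable_grad_param[OF prob_\<mu> _ moment_\<mu>]

lemmas integrable_exact_min = integrable_potential[OF prob_\<nu> _ moment_exact_min]
  integrable_grad_param_square[OF prob_\<nu> _ moment_exact_min]
  integrable_grad_param[OF prob_\<nu> _ moment_exact_min]

lemma integrable_env: "integrable \<nu> (env \<theta>)"
proof -
  have "integrable \<nu> (\<lambda>z. (norm (exact_min g \<theta> z - z))\<^sup>2)"
  proof (rule integrable_dominated)
    let ?b = "\<lambda>z. 2 * (norm (exact_min g \<theta> z))\<^sup>2 + 2 * (norm z)\<^sup>2"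
    show "integrable \<nu> ?b" using moment_\<nu> moment_exact_min by simp
    show "\<bar>(norm (exact_min g \<theta> z - z))\<^sup>2\<bar> \<le> ?b z" for z
      using norm_diff_square_le by simp
  qed measurable
  then show ?thesis
    unfolding env_def[abs_def] using integrable_exact_min(1) by simp
qed

text \<open>The formula expected for the gradient of the loss; \<open>grad_loss\<close> proves that
  it is the gradient.\<close>

definition G :: "real^'p \<Rightarrow> real^'p" where
  "G \<theta> = (\<integral>x. grad_param g \<theta> x \<partial>\<mu>) - (\<integral>z. grad_param g \<theta> (exact_min g \<theta> z) \<partial>\<nu>)"

lemma measurable_G [measurable]: "G \<in> borel_measurable borel"
  unfolding G_def[abs_def] by measurable

lemma loss_eq: "loss \<mu> \<nu> g \<theta> = (\<integral>x. g \<theta> x \<partial>\<mu>) - (\<integral>z. env \<theta> z \<partial>\<nu>)"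
  by (simp add: loss_def env_def)

text \<open>The expansions of the potential and of the envelope have error bounds uniform in the
  sample, so they survive integration against probability measures. The constants \<open>Lth\<close>
  and \<open>Lth + Lth * Ly\<close> add up.\<close>

lemma loss_expansion:
  "\<bar>loss \<mu> \<nu> g (\<theta> + h) - loss \<mu> \<nu> g \<theta> - inner h (G \<theta>)\<bar> \<le> (2 * Lth + Lth * Ly) * (norm h)\<^sup>2"
proof -
  let ?a = "\<lambda>x. g (\<theta> + h) x - g \<theta> x - inner h (grad_param g \<theta> x)"
  let ?b = "\<lambda>z. env (\<theta> + h) z - env \<theta> z - inner h (grad_param g \<theta> (exact_min g \<theta> z))"
  have "loss \<mu> \<nu> g (\<theta> + h) - loss \<mu> \<nu> g \<theta> - inner h (G \<theta>) = (\<integral>x. ?a x \<partial>\<mu>) - (\<integral>z. ?b z \<partial>\<nu>)"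
    using integrable_\<mu> integrable_exact_min integrable_env
    by (simp add: loss_eq G_def inner_diff_right)
  moreover have "\<bar>\<integral>x. ?a x \<partial>\<mu>\<bar> \<le> Lth * (norm h)\<^sup>2"
    using integrable_\<mu> by (intro \<mu>.norm_expectation_le_const param_expansion) auto
  moreover have "\<bar>\<integral>z. ?b z \<partial>\<nu>\<bar> \<le> (Lth + Lth * Ly) * (norm h)\<^sup>2"
    using integrable_env integrable_exact_min by (intro \<nu>.norm_expectation_le_const env_expansion) auto
  ultimately show ?thesis by (simp add: algebra_simps)
qed

lemma GDERIV_loss: "GDERIV (loss \<mu> \<nu> g) \<theta> :> G \<theta>"
  by (rule GDERIV_quadratic_remainder[OF loss_expansion])

lemma grad_loss: "grad (loss \<mu> \<nu> g) = G"
  using GDERIV_grad[OF GDERIV_loss] by auto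

lemma measurable_loss [measurable]: "loss \<mu> \<nu> g \<in> borel_measurable borel"
  by (rule borel_measurable_continuous_onI, rule continuous_at_imp_continuous_on)
    (use GDERIV_loss has_derivative_continuous in \<open>unfold gderiv_def, blast\<close>)

text \<open>Every sample \<open>x\<close> is admissible in the minimization that defines the envelope at \<open>z\<close>, so the
  envelope at \<open>z\<close> is at most \<open>g \<theta> x\<close> plus a transport cost that does not depend on \<open>\<theta>\<close>.\<close>

lemma loss_bounded_below:
  "- ((\<integral>x. (norm x)\<^sup>2 \<partial>\<mu>) + (\<integral>z. (norm z)\<^sup>2 \<partial>\<nu>)) \<le> loss \<mu> \<nu> g \<theta>"
proof -
  let ?I = "(\<integral>x. (norm x)\<^sup>2 \<partial>\<mu>) + (\<integral>x. g \<theta> x \<partial>\<mu>)"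
  have "env \<theta> z \<le> ?I + (norm z)\<^sup>2" for z
  proof -
    \<comment> \<open>The left integrand is constant in \<open>x\<close>. Averaging the right side
      over \<mu> produces exactly the mean potential that occurs in the loss and cancels
      there.\<close>
    have "(\<integral>x. env \<theta> z \<partial>\<mu>) \<le> (\<integral>x. (norm x)\<^sup>2 + (norm z)\<^sup>2 + g \<theta> x \<partial>\<mu>)"
    proof (rule integral_mono)
      fix x
      show "env \<theta> z \<le> (norm x)\<^sup>2 + (norm z)\<^sup>2 + g \<theta> x"
        using env_le[of \<theta> z x] norm_diff_square_le[of x z] by simp
    qed (use moment_\<mu> integrable_\<mu>(1) in auto)
    also have "\<dots> = ?I + (norm z)\<^sup>2"
      using moment_\<mu> integrable_\<mu>(1) \<mu>.prob_space by simp
    finally show ?thesis using \<mu>.prob_space by simp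
  qed
  then have "(\<integral>z. env \<theta> z \<partial>\<nu>) \<le> (\<integral>z. ?I + (norm z)\<^sup>2 \<partial>\<nu>)"
    using integrable_env moment_\<nu> by (intro integral_mono) auto
  also have "\<dots> = ?I + (\<integral>z. (norm z)\<^sup>2 \<partial>\<nu>)"
    using moment_\<nu> \<nu>.prob_space by simp
  finally show ?thesis by (simp add: loss_eq)
qed

end

section \<open>Moments of the stochastic gradient\<close>

lemma prob_space_batch_law:
  assumes "prob_space \<mu>" "prob_space \<nu>"
  shows "prob_space (batch_law B \<mu> \<nu>)"
  unfolding batch_law_def using assms by (intro prob_space_pair prob_space_PiM)

lemma measurable_batch_law_component:
  assumes "i < B"
  shows "(\<lambda>b. fst b i) \<in> measurable (batch_law B \<mu> \<nu>) \<mu>"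
    and "(\<lambda>b. snd b i) \<in> measurable (batch_law B \<mu> \<nu>) \<nu>"
  unfolding batch_law_def
  by (rule measurable_compose[OF measurable_fst measurable_component_singleton]
        measurable_compose[OF measurable_snd measurable_component_singleton];
      use assms in simp)+

lemma distr_batch_law_component:
  assumes "prob_space \<mu>" "prob_space \<nu>" "i < B"
  shows "distr (batch_law B \<mu> \<nu>) \<mu> (\<lambda>b. fst b i) = \<mu>"
    and "distr (batch_law B \<mu> \<nu>) \<nu> (\<lambda>b. snd b i) = \<nu>"
proof -
  interpret P: prob_space "PiM {..<B} (\<lambda>_. \<mu>)" using assms by (intro prob_space_PiM)
  interpret Q: prob_space "PiM {..<B} (\<lambda>_. \<nu>)" using assms by (intro prob_space_PiM)
  interpret PQ: pair_prob_space "PiM {..<B} (\<lambda>_. \<mu>)" "PiM {..<B} (\<lambda>_. \<nu>)" ..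
  have "distr (batch_law B \<mu> \<nu>) \<mu> (\<lambda>b. fst b i)
      = distr (distr (batch_law B \<mu> \<nu>) (PiM {..<B} (\<lambda>_. \<mu>)) fst) \<mu> (\<lambda>f. f i)"
    using assms(3) by (subst distr_distr) (auto simp: batch_law_def comp_def)
  then show "distr (batch_law B \<mu> \<nu>) \<mu> (\<lambda>b. fst b i) = \<mu>"
    using assms distr_PiM_component[of "{..<B}" "\<lambda>_. \<mu>" i]
    by (simp add: batch_law_def Q.distr_pair_fst)
  have "distr (batch_law B \<mu> \<nu>) (PiM {..<B} (\<lambda>_. \<nu>)) snd = PiM {..<B} (\<lambda>_. \<nu>)"
  proof -
    \<comment> \<open>Swapping the two factors reduces the second marginal to the first.\<close>
    have "distr (batch_law B \<mu> \<nu>) (PiM {..<B} (\<lambda>_. \<nu>)) snd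
        = distr (PiM {..<B} (\<lambda>_. \<nu>) \<Otimes>\<^sub>M PiM {..<B} (\<lambda>_. \<mu>)) (PiM {..<B} (\<lambda>_. \<nu>)) fst"
      unfolding batch_law_def
      by (subst PQ.distr_pair_swap, subst distr_distr) (auto simp: comp_def case_prod_unfold)
    then show ?thesis by (simp add: P.distr_pair_fst)
  qed
  moreover have "distr (batch_law B \<mu> \<nu>) \<nu> (\<lambda>b. snd b i)
      = distr (distr (batch_law B \<mu> \<nu>) (PiM {..<B} (\<lambda>_. \<nu>)) snd) \<nu> (\<lambda>f. f i)"
    using assms(3) by (subst distr_distr) (auto simp: batch_law_def comp_def)
  ultimately show "distr (batch_law B \<mu> \<nu>) \<nu> (\<lambda>b. snd b i) = \<nu>"
    using assms distr_PiM_component[of "{..<B}" "\<lambda>_. \<nu>" i] by simp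
qed

lemma norm_average_square_le:
  fixes f :: "nat \<Rightarrow> 'a::real_inner"
  shows "(norm ((1 / real B) *\<^sub>R (\<Sum>i<B. f i)))\<^sup>2 \<le> (1 / real B) * (\<Sum>i<B. (norm (f i))\<^sup>2)"
proof -
  have "(norm (\<Sum>i<B. f i))\<^sup>2 \<le> (\<Sum>i<B. norm (f i))\<^sup>2"
    by (intro power_mono norm_sum) auto
  also have "\<dots> \<le> (\<Sum>i<B. (norm (f i))\<^sup>2) * real B"
    using sum_squared_le_sum_of_squares[of "\<lambda>i. norm (f i)" "{..<B}"] by simp
  finally show ?thesis
    \<comment> \<open>For \<open>B = 0\<close> both sides are 0, since \<open>1 / real B\<close> is
      then 0.\<close>
    by (cases "B = 0") (auto simp: power_mult_distrib power2_eq_square field_simps)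
qed

text \<open>The accuracy condition is phrased with \<open>G\<close>, which \<open>grad_loss\<close>
  identifies with the gradient of the loss.\<close>

locale approximate_dual_loss = lipschitz_dual_loss g Lth Ly \<mu> \<nu>
  for g :: "real^'p \<Rightarrow> real^'d \<Rightarrow> real" and Lth Ly :: real and \<mu> \<nu> :: "(real^'d) measure" +
  fixes ytil :: "real^'p \<Rightarrow> real^'d \<Rightarrow> real^'d" and Mx Mz V :: real and eps :: "real^'p \<Rightarrow> real"
    and B :: nat
  assumes measurable_ytil: "(\<lambda>(\<theta>, z). ytil \<theta> z) \<in> borel_measurable borel"
    and Mx_pos: "0 < Mx" and Mz_pos: "0 < Mz"
    and Mx: "\<And>\<theta>. (\<integral>x. (norm (grad_param g \<theta> x))\<^sup>2 \<partial>\<mu>) < Mx"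
    and Mz_ytil: "\<And>\<theta>. (\<integral>z. (norm (grad_param g \<theta> (ytil \<theta> z)))\<^sup>2 \<partial>\<nu>) < Mz"
    and Mz_exact_min: "\<And>\<theta>. (\<integral>z. (norm (grad_param g \<theta> (exact_min g \<theta> z)))\<^sup>2 \<partial>\<nu>) < Mz"
    and V_nonneg: "0 \<le> V"
    and ytil_close: "\<And>\<theta> z. norm (ytil \<theta> z - exact_min g \<theta> z) < eps \<theta>"
    and eps_le: "\<And>\<theta>. eps \<theta> \<le> V * (norm (G \<theta>))\<^sup>2 / (Lth * (sqrt Mx + sqrt Mz))"
    and B_pos: "1 \<le> B"
begin

section \<open>Bias of the approximate expected step\<close>

lemma measurable_ytil' [measurable]:
  assumes [measurable]: "f \<in> borel_measurable N" "h \<in> borel_measurable N"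
  shows "(\<lambda>x. ytil (f x) (h x)) \<in> borel_measurable N"
proof -
  have "(\<lambda>x. (f x, h x)) \<in> borel_measurable N" by measurable
  from measurable_compose[OF this measurable_ytil] show ?thesis by simp
qed

lemma moment_ytil: "integrable \<nu> (\<lambda>z. (norm (ytil \<theta> z))\<^sup>2)"
proof (rule integrable_dominated)
  let ?b = "\<lambda>z. 2 * (norm (exact_min g \<theta> z))\<^sup>2 + 2 * (eps \<theta>)\<^sup>2"
  show "integrable \<nu> ?b" using moment_exact_min by simp
  show "\<bar>(norm (ytil \<theta> z))\<^sup>2\<bar> \<le> ?b z" for z
  proof -
    have "norm (exact_min g \<theta> z - ytil \<theta> z) \<le> eps \<theta>"
      using ytil_close[of \<theta> z] by (simp add: norm_minus_commute)
    then have "(norm (exact_min g \<theta> z - ytil \<theta> z))\<^sup>2 \<le> (eps \<theta>)\<^sup>2"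
      by (intro power_mono) auto
    then show ?thesis
      using norm_diff_square_le[of "exact_min g \<theta> z" "exact_min g \<theta> z - ytil \<theta> z"] by simp
  qed
qed measurable

lemmas integrable_ytil = integrable_grad_param_square[OF prob_\<nu> _ moment_ytil]
  integrable_grad_param[OF prob_\<nu> _ moment_ytil]

definition mean_step :: "real^'p \<Rightarrow> real^'p" where
  "mean_step \<theta> = (\<integral>x. grad_param g \<theta> x \<partial>\<mu>) - (\<integral>z. grad_param g \<theta> (ytil \<theta> z) \<partial>\<nu>)"

text \<open>Each expectation in \<open>G\<close> is bounded by the square root of its second moment.
  The resulting sum is the denominator in \<open>eps_le\<close>, so that it cancels in
  \<open>inner_G_mean_step_ge\<close>.\<close>

lemma norm_G_le: "norm (G \<theta>) \<le> sqrt Mx + sqrt Mz"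
proof -
  have "norm (\<integral>x. grad_param g \<theta> x \<partial>\<mu>) \<le> sqrt (\<integral>x. (norm (grad_param g \<theta> x))\<^sup>2 \<partial>\<mu>)"
    using integrable_\<mu> by (intro \<mu>.norm_expectation_le_sqrt) auto
  moreover have "norm (\<integral>z. grad_param g \<theta> (exact_min g \<theta> z) \<partial>\<nu>)
      \<le> sqrt (\<integral>z. (norm (grad_param g \<theta> (exact_min g \<theta> z)))\<^sup>2 \<partial>\<nu>)"
    using integrable_exact_min by (intro \<nu>.norm_expectation_le_sqrt) auto
  moreover have "sqrt (\<integral>x. (norm (grad_param g \<theta> x))\<^sup>2 \<partial>\<mu>) \<le> sqrt Mx"
    "sqrt (\<integral>z. (norm (grad_param g \<theta> (exact_min g \<theta> z)))\<^sup>2 \<partial>\<nu>) \<le> sqrt Mz"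
    using Mx[of \<theta>] Mz_exact_min[of \<theta>] by auto
  ultimately show ?thesis
    unfolding G_def by (intro order_trans[OF norm_triangle_ineq4]) linarith
qed

text \<open>The \<mu>-terms cancel, and under \<nu> the integrands differ by at most
  \<open>Lth\<close> times the distance of the two minimizers.\<close>

lemma norm_mean_step_bias_le:
  "norm (mean_step \<theta> - G \<theta>) \<le> V * (norm (G \<theta>))\<^sup>2 / (sqrt Mx + sqrt Mz)"
proof -
  let ?b = "\<lambda>z. grad_param g \<theta> (exact_min g \<theta> z) - grad_param g \<theta> (ytil \<theta> z)"
  have int: "integrable \<nu> ?b"
    using integrable_exact_min integrable_ytil by auto
  have "mean_step \<theta> - G \<theta> = (\<integral>z. ?b z \<partial>\<nu>)"
    using integrable_exact_min integrable_ytil by (simp add: mean_step_def G_def)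
  also have "norm \<dots> \<le> (\<integral>z. norm (?b z) \<partial>\<nu>)"
    by (rule integral_norm_bound)
  also have "\<dots> \<le> Lth * eps \<theta>"
  proof (rule \<nu>.integral_le_const)
    have "norm (?b z) \<le> Lth * eps \<theta>" for z
      using ytil_close[of \<theta> z] Lth_nonneg
      by (intro order_trans[OF grad_param_lipschitz(2)] mult_left_mono)
        (auto simp: norm_minus_commute)
    then show "AE z in \<nu>. norm (?b z) \<le> Lth * eps \<theta>" by simp
  qed (use int in auto)
  also have "\<dots> \<le> V * (norm (G \<theta>))\<^sup>2 / (sqrt Mx + sqrt Mz)"
  \<comment> \<open>The factor \<open>Lth\<close> cancels only if it is nonzero; otherwise the left
    side is 0 and the right side is nonnegative.\<close>
  proof (cases "Lth = 0")
    case False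
    then have "Lth * eps \<theta> \<le> Lth * (V * (norm (G \<theta>))\<^sup>2 / (Lth * (sqrt Mx + sqrt Mz)))"
      using Lth_nonneg eps_le by (intro mult_left_mono)
    then show ?thesis using False by simp
  qed (use V_nonneg Mx_pos Mz_pos in simp)
  finally show ?thesis .
qed

text \<open>By Cauchy-Schwarz the bias contributes at most \<open>norm (G \<theta>)\<close> times
  its own norm. Bounding that first factor by \<open>s\<close> cancels the denominator and leaves a
  fraction \<open>V\<close> of the squared gradient.\<close>

lemma inner_G_mean_step_ge: "(1 - V) * (norm (G \<theta>))\<^sup>2 \<le> inner (G \<theta>) (mean_step \<theta>)"
proof -
  define s where "s = sqrt Mx + sqrt Mz"
  have s: "0 < s" using Mx_pos Mz_pos by (simp add: s_def add_pos_pos)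
  have "\<bar>inner (G \<theta>) (mean_step \<theta> - G \<theta>)\<bar> \<le> norm (G \<theta>) * norm (mean_step \<theta> - G \<theta>)"
    by (rule Cauchy_Schwarz_ineq2)
  also have "\<dots> \<le> s * (V * (norm (G \<theta>))\<^sup>2 / s)"
    using norm_G_le norm_mean_step_bias_le s unfolding s_def[symmetric]
    by (intro mult_mono) auto
  also have "\<dots> = V * (norm (G \<theta>))\<^sup>2" using s by simp
  finally show ?thesis
    by (simp add: inner_diff_right dot_square_norm algebra_simps abs_le_iff)
qed

section \<open>First and second moments of a minibatch step\<close>

abbreviation Q :: "((nat \<Rightarrow> real^'d) \<times> (nat \<Rightarrow> real^'d)) measure" where
  "Q \<equiv> batch_law B \<mu> \<nu>"

sublocale Q: prob_space Q by (rule prob_space_batch_law[OF prob_\<mu> prob_\<nu>])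

lemma measurable_batch_component [measurable]:
  assumes "i < B" "f \<in> measurable N Q"
  shows "(\<lambda>b. fst (f b) i) \<in> borel_measurable N" "(\<lambda>b. snd (f b) i) \<in> borel_measurable N"
  using measurable_compose[OF assms(2) measurable_batch_law_component(1)[OF assms(1), of \<mu> \<nu>]]
    measurable_compose[OF assms(2) measurable_batch_law_component(2)[OF assms(1), of \<mu> \<nu>]]
    measurable_cong_sets[OF refl sets_\<mu>, of N] measurable_cong_sets[OF refl sets_\<nu>, of N]
  by auto

lemma integral_batch_component:
  fixes f :: "real^'d \<Rightarrow> 'b::{banach, second_countable_topology}"
  assumes [measurable]: "f \<in> borel_measurable borel" and "i < B"
  shows "(\<integral>b. f (fst b i) \<partial>Q) = (\<integral>x. f x \<partial>\<mu>)"
    and "(\<integral>b. f (snd b i) \<partial>Q) = (\<integral>z. f z \<partial>\<nu>)"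
    and "integrable \<mu> f \<Longrightarrow> integrable Q (\<lambda>b. f (fst b i))"
    and "integrable \<nu> f \<Longrightarrow> integrable Q (\<lambda>b. f (snd b i))"
  using integral_distr[OF measurable_batch_law_component(1), of i B f \<mu> \<nu>]
    integral_distr[OF measurable_batch_law_component(2), of i B f \<nu> \<mu>]
    integrable_distr_eq[OF measurable_batch_law_component(1), of i B f \<mu> \<nu>]
    integrable_distr_eq[OF measurable_batch_law_component(2), of i B f \<nu> \<mu>]
    distr_batch_law_component[OF prob_\<mu> prob_\<nu> assms(2)] assms(2)
  by simp_all

lemma measurable_stoch_grad [measurable]:
  assumes [measurable]: "f \<in> measurable N Q" "h \<in> borel_measurable N"
  shows "(\<lambda>x. stoch_grad g ytil B (f x) (h x)) \<in> borel_measurable N"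
  unfolding stoch_grad_def by measurable

lemma
  shows integrable_stoch_grad: "integrable Q (\<lambda>b. stoch_grad g ytil B b \<theta>)"
    and expectation_stoch_grad: "(\<integral>b. stoch_grad g ytil B b \<theta> \<partial>Q) = mean_step \<theta>"
proof -
  have *: "integrable Q (\<lambda>b. grad_param g \<theta> (fst b i))"
    "integrable Q (\<lambda>b. grad_param g \<theta> (ytil \<theta> (snd b i)))"
    "(\<integral>b. grad_param g \<theta> (fst b i) \<partial>Q) = (\<integral>x. grad_param g \<theta> x \<partial>\<mu>)"
    "(\<integral>b. grad_param g \<theta> (ytil \<theta> (snd b i)) \<partial>Q) = (\<integral>z. grad_param g \<theta> (ytil \<theta> z) \<partial>\<nu>)"
    if "i < B" for i
    using that integrable_\<mu>(3) integrable_ytil(2)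
    by (auto intro!: integral_batch_component[where f = "grad_param g \<theta>"]
        integral_batch_component[where f = "\<lambda>z. grad_param g \<theta> (ytil \<theta> z)"])
  have sum: "integrable Q (\<lambda>b. \<Sum>i<B. grad_param g \<theta> (fst b i))"
    "integrable Q (\<lambda>b. \<Sum>i<B. grad_param g \<theta> (ytil \<theta> (snd b i)))"
    using * by (auto intro: Bochner_Integration.integrable_sum)
  then show "integrable Q (\<lambda>b. stoch_grad g ytil B b \<theta>)"
    unfolding stoch_grad_def by simp
  have "(\<integral>b. (\<Sum>i<B. grad_param g \<theta> (fst b i)) \<partial>Q) = real B *\<^sub>R (\<integral>x. grad_param g \<theta> x \<partial>\<mu>)"
    "(\<integral>b. (\<Sum>i<B. grad_param g \<theta> (ytil \<theta> (snd b i))) \<partial>Q)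
      = real B *\<^sub>R (\<integral>z. grad_param g \<theta> (ytil \<theta> z) \<partial>\<nu>)"
    using * by (simp_all add: Bochner_Integration.integral_sum sum_constant_scaleR del: sum_constant)
  then show "(\<integral>b. stoch_grad g ytil B b \<theta> \<partial>Q) = mean_step \<theta>"
    unfolding stoch_grad_def mean_step_def using sum B_pos by simp
qed

text \<open>Separating the two averages costs a factor 2, and the square of an average is at most
  the average of the squares. The bound thus depends neither on \<open>B\<close> nor on
  \<theta>.\<close>

lemma
  shows integrable_stoch_grad_square: "integrable Q (\<lambda>b. (norm (stoch_grad g ytil B b \<theta>))\<^sup>2)"
    and expectation_stoch_grad_square_le:
      "(\<integral>b. (norm (stoch_grad g ytil B b \<theta>))\<^sup>2 \<partial>Q) \<le> 2 * (Mx + Mz)"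
proof -
  let ?R = "\<lambda>b. 2 * ((1 / real B) * (\<Sum>i<B. (norm (grad_param g \<theta> (fst b i)))\<^sup>2))
    + 2 * ((1 / real B) * (\<Sum>i<B. (norm (grad_param g \<theta> (ytil \<theta> (snd b i))))\<^sup>2))"
  have *: "integrable Q (\<lambda>b. (norm (grad_param g \<theta> (fst b i)))\<^sup>2)"
    "integrable Q (\<lambda>b. (norm (grad_param g \<theta> (ytil \<theta> (snd b i))))\<^sup>2)"
    "(\<integral>b. (norm (grad_param g \<theta> (fst b i)))\<^sup>2 \<partial>Q) = (\<integral>x. (norm (grad_param g \<theta> x))\<^sup>2 \<partial>\<mu>)"
    "(\<integral>b. (norm (grad_param g \<theta> (ytil \<theta> (snd b i))))\<^sup>2 \<partial>Q)
      = (\<integral>z. (norm (grad_param g \<theta> (ytil \<theta> z)))\<^sup>2 \<partial>\<nu>)"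
    if "i < B" for i
    using that integrable_\<mu>(2) integrable_ytil(1)
    by (auto intro!: integral_batch_component[where f = "\<lambda>x. (norm (grad_param g \<theta> x))\<^sup>2"]
        integral_batch_component[where f = "\<lambda>z. (norm (grad_param g \<theta> (ytil \<theta> z)))\<^sup>2"])
  have sum: "integrable Q (\<lambda>b. \<Sum>i<B. (norm (grad_param g \<theta> (fst b i)))\<^sup>2)"
    "integrable Q (\<lambda>b. \<Sum>i<B. (norm (grad_param g \<theta> (ytil \<theta> (snd b i))))\<^sup>2)"
    "(\<integral>b. (\<Sum>i<B. (norm (grad_param g \<theta> (fst b i)))\<^sup>2) \<partial>Q)
      = real B * (\<integral>x. (norm (grad_param g \<theta> x))\<^sup>2 \<partial>\<mu>)"
    "(\<integral>b. (\<Sum>i<B. (norm (grad_param g \<theta> (ytil \<theta> (snd b i))))\<^sup>2) \<partial>Q)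
      = real B * (\<integral>z. (norm (grad_param g \<theta> (ytil \<theta> z)))\<^sup>2 \<partial>\<nu>)"
    using * by (auto simp: Bochner_Integration.integral_sum intro!: Bochner_Integration.integrable_sum)
  then have R: "integrable Q ?R"
    by (intro Bochner_Integration.integrable_add integrable_mult_right)
  have le: "(norm (stoch_grad g ytil B b \<theta>))\<^sup>2 \<le> ?R b" for b
    unfolding stoch_grad_def
    by (rule order_trans[OF norm_diff_square_le add_mono]; intro mult_left_mono norm_average_square_le) auto
  show int: "integrable Q (\<lambda>b. (norm (stoch_grad g ytil B b \<theta>))\<^sup>2)"
  proof (rule integrable_dominated[OF R])
    show "\<bar>(norm (stoch_grad g ytil B b \<theta>))\<^sup>2\<bar> \<le> ?R b" for b
      using le[of b] by (simp only: abs_power2)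
  qed measurable
  have "(\<integral>b. (norm (stoch_grad g ytil B b \<theta>))\<^sup>2 \<partial>Q) \<le> (\<integral>b. ?R b \<partial>Q)"
    using int R le by (intro integral_mono) auto
  also have "\<dots> = 2 * (\<integral>x. (norm (grad_param g \<theta> x))\<^sup>2 \<partial>\<mu>) + 2 * (\<integral>z. (norm (grad_param g \<theta> (ytil \<theta> z)))\<^sup>2 \<partial>\<nu>)"
    using sum B_pos by simp
  also have "\<dots> \<le> 2 * (Mx + Mz)"
    using Mx[of \<theta>] Mz_ytil[of \<theta>] by simp
  finally show "(\<integral>b. (norm (stoch_grad g ytil B b \<theta>))\<^sup>2 \<partial>Q) \<le> 2 * (Mx + Mz)" .
qed

text \<open>Here \<open>P\<close> stands for the law of the current iterate and \<open>Q\<close> for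
  that of a fresh batch. Under the product law Fubini integrates the batch first at fixed \<theta>,
  which takes the place of conditioning on the past.\<close>

lemma
  assumes P: "prob_space P" and sets_P [measurable_cong]: "sets P = sets borel"
  shows integrable_pair_stoch_grad_square:
      "integrable (P \<Otimes>\<^sub>M Q) (\<lambda>p. (norm (stoch_grad g ytil B (snd p) (fst p)))\<^sup>2)"
    and expectation_pair_stoch_grad_square_le:
      "(\<integral>p. (norm (stoch_grad g ytil B (snd p) (fst p)))\<^sup>2 \<partial>(P \<Otimes>\<^sub>M Q)) \<le> 2 * (Mx + Mz)"
    and integrable_pair_inner:
      "integrable (P \<Otimes>\<^sub>M Q) (\<lambda>p. inner (G (fst p)) (stoch_grad g ytil B (snd p) (fst p)))"
    and expectation_pair_inner_ge:
      "(1 - V) * (\<integral>\<theta>. (norm (G \<theta>))\<^sup>2 \<partial>P)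
        \<le> (\<integral>p. inner (G (fst p)) (stoch_grad g ytil B (snd p) (fst p)) \<partial>(P \<Otimes>\<^sub>M Q))"
proof -
  interpret P: prob_space P by fact
  interpret PQ: pair_prob_space P Q ..
  let ?d = "\<lambda>p. stoch_grad g ytil B (snd p) (fst p)"
  show sq: "integrable (P \<Otimes>\<^sub>M Q) (\<lambda>p. (norm (?d p))\<^sup>2)"
  \<comment> \<open>Tonelli comes first: the inner integral is bounded uniformly in \<theta>, so the
    double integral is finite and Fubini becomes applicable.\<close>
  proof (rule integrableI_bounded)
    have "(\<integral>\<^sup>+p. ennreal (norm ((norm (?d p))\<^sup>2)) \<partial>(P \<Otimes>\<^sub>M Q))
        = (\<integral>\<^sup>+\<theta>. \<integral>\<^sup>+b. ennreal ((norm (stoch_grad g ytil B b \<theta>))\<^sup>2) \<partial>Q \<partial>P)"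
      by (subst Q.nn_integral_fst[symmetric]) auto
    also have "\<dots> = (\<integral>\<^sup>+\<theta>. ennreal (\<integral>b. (norm (stoch_grad g ytil B b \<theta>))\<^sup>2 \<partial>Q) \<partial>P)"
      using integrable_stoch_grad_square by (subst nn_integral_eq_integral) auto
    also have "\<dots> \<le> (\<integral>\<^sup>+\<theta>. ennreal (2 * (Mx + Mz)) \<partial>P)"
      by (intro nn_integral_mono ennreal_leI expectation_stoch_grad_square_le)
    also have "\<dots> < \<infinity>" by (simp add: P.emeasure_space_1)
    finally show "(\<integral>\<^sup>+p. ennreal (norm ((norm (?d p))\<^sup>2)) \<partial>(P \<Otimes>\<^sub>M Q)) < \<infinity>" .
  qed measurable
  have "(\<integral>p. (norm (?d p))\<^sup>2 \<partial>(P \<Otimes>\<^sub>M Q)) = (\<integral>\<theta>. \<integral>b. (norm (stoch_grad g ytil B b \<theta>))\<^sup>2 \<partial>Q \<partial>P)"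
    using PQ.integral_fst'[OF sq] by simp
  also have "\<dots> \<le> 2 * (Mx + Mz)"
    using PQ.integrable_fst'[OF sq] expectation_stoch_grad_square_le
    by (intro P.integral_le_const) auto
  finally show "(\<integral>p. (norm (?d p))\<^sup>2 \<partial>(P \<Otimes>\<^sub>M Q)) \<le> 2 * (Mx + Mz)" .
  \<comment> \<open>The uniform bound \<open>s\<close> on \<open>G\<close> makes its square
    integrable under \<open>P\<close> and lets \<open>s * norm (?d p)\<close> dominate the inner
    product.\<close>
  define s where "s = sqrt Mx + sqrt Mz"
  have s: "0 \<le> s" "norm (G \<theta>) \<le> s" for \<theta>
    using Mx_pos Mz_pos norm_G_le by (auto simp: s_def)
  have G_sq: "integrable P (\<lambda>\<theta>. (norm (G \<theta>))\<^sup>2)"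
    using s by (intro P.integrable_const_bound[of _ "s\<^sup>2"]) (auto intro: power_mono)
  have "integrable (P \<Otimes>\<^sub>M Q) ?d"
    by (rule PQ.integrable_if_square_integrable) (measurable, rule sq)
  then have "integrable (P \<Otimes>\<^sub>M Q) (\<lambda>p. s * norm (?d p))" by auto
  then show inner: "integrable (P \<Otimes>\<^sub>M Q) (\<lambda>p. inner (G (fst p)) (?d p))"
  proof (rule integrable_dominated)
    show "\<bar>inner (G (fst p)) (?d p)\<bar> \<le> s * norm (?d p)" for p
      by (rule order_trans[OF Cauchy_Schwarz_ineq2]) (intro mult_right_mono s(2) norm_ge_zero)
  qed measurable
  have "(1 - V) * (\<integral>\<theta>. (norm (G \<theta>))\<^sup>2 \<partial>P) = (\<integral>\<theta>. (1 - V) * (norm (G \<theta>))\<^sup>2 \<partial>P)" by simp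
  also have "\<dots> \<le> (\<integral>\<theta>. inner (G \<theta>) (mean_step \<theta>) \<partial>P)"
  proof (rule integral_mono)
    show "integrable P (\<lambda>\<theta>. inner (G \<theta>) (mean_step \<theta>))"
      using PQ.integrable_fst'[OF inner] integrable_stoch_grad expectation_stoch_grad by simp
  qed (use G_sq inner_G_mean_step_ge in auto)
  also have "\<dots> = (\<integral>p. inner (G (fst p)) (?d p) \<partial>(P \<Otimes>\<^sub>M Q))"
    using PQ.integral_fst'[OF inner] integrable_stoch_grad expectation_stoch_grad by simp
  finally show "(1 - V) * (\<integral>\<theta>. (norm (G \<theta>))\<^sup>2 \<partial>P) \<le> (\<integral>p. inner (G (fst p)) (?d p) \<partial>(P \<Otimes>\<^sub>M Q))" .
qed

end

section \<open>Convergence of the iteration\<close>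

text \<open>A positive lower limit would keep \<open>a j\<close> above some \<open>c > 0\<close>
  from an index \<open>N\<close> on. The weighted sums would then dominate \<open>c\<close> times
  the partial sums of \<alpha> up to a constant, and so diverge.\<close>

lemma liminf_eq_0_if_weighted_sums_bounded:
  fixes a \<alpha> :: "nat \<Rightarrow> real"
  assumes a: "\<And>j. 0 \<le> a j" and \<alpha>: "\<And>j. 0 \<le> \<alpha> j"
    and divergent: "filterlim (\<lambda>n. \<Sum>j<n. \<alpha> j) at_top sequentially"
    and bounded: "\<And>n. (\<Sum>j<n. \<alpha> j * a j) \<le> C"
  shows "liminf (\<lambda>j. ereal (a j)) = 0"
proof (rule antisym)
  show "0 \<le> liminf (\<lambda>j. ereal (a j))"
    using a by (intro Liminf_bounded always_eventually) auto
  show "liminf (\<lambda>j. ereal (a j)) \<le> 0"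
  proof (rule ccontr)
    assume "\<not> ?thesis"
    then obtain c where c: "0 < ereal c" "ereal c < liminf (\<lambda>j. ereal (a j))"
      using ereal_dense2[of 0 "liminf (\<lambda>j. ereal (a j))"] by (auto simp: not_le)
    then obtain N where N: "\<And>j. N \<le> j \<Longrightarrow> c < a j"
      using less_LiminfD[OF c(2)] by (auto simp: eventually_sequentially)
    have "c * (\<Sum>j<n. \<alpha> j) \<le> C + c * (\<Sum>j<N. \<alpha> j)" for n
    proof -
      \<comment> \<open>The extra summand pays for the indices below \<open>N\<close>, so the
        inequality holds for every \<open>j\<close> and the sum over \<open>j < n\<close> needs no
        case distinction on \<open>n\<close>.\<close>
      have "c * \<alpha> j \<le> \<alpha> j * a j + (if j < N then c * \<alpha> j else 0)" for j
        using N[of j] a[of j] \<alpha>[of j] mult_left_mono[of c "a j" "\<alpha> j"] by (auto simp: mult.commute)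
      then have "(\<Sum>j<n. c * \<alpha> j) \<le> (\<Sum>j<n. \<alpha> j * a j + (if j < N then c * \<alpha> j else 0))"
        by (rule sum_mono)
      also have "\<dots> = (\<Sum>j<n. \<alpha> j * a j) + (\<Sum>j\<in>{..<n} \<inter> {..<N}. c * \<alpha> j)"
        by (simp add: sum.distrib sum.inter_restrict lessThan_def)
      also have "(\<Sum>j\<in>{..<n} \<inter> {..<N}. c * \<alpha> j) \<le> (\<Sum>j<N. c * \<alpha> j)"
        using c(1) \<alpha> by (intro sum_mono2) auto
      finally show ?thesis using bounded[of n] by (simp add: sum_distrib_left)
    qed
    then have "(\<Sum>j<n. \<alpha> j) \<le> (C + c * (\<Sum>j<N. \<alpha> j)) / c" for n
      using c(1) by (simp add: pos_le_divide_eq mult.commute)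
    moreover obtain n where "(C + c * (\<Sum>j<N. \<alpha> j)) / c + 1 \<le> (\<Sum>j<n. \<alpha> j)"
      using divergent unfolding filterlim_at_top eventually_sequentially by blast
    ultimately show False by (metis add_le_same_cancel1 not_one_le_zero order_trans)
  qed
qed

locale sgd_run = approximate_dual_loss g Lth Ly \<mu> \<nu> ytil Mx Mz V eps B + prob_space M
  for g :: "real^'p \<Rightarrow> real^'d \<Rightarrow> real" and Lth Ly :: real and \<mu> \<nu> :: "(real^'d) measure"
    and ytil :: "real^'p \<Rightarrow> real^'d \<Rightarrow> real^'d" and Mx Mz V :: real and eps :: "real^'p \<Rightarrow> real"
    and B :: nat and M :: "'w measure" +
  fixes \<alpha> :: "nat \<Rightarrow> real" and \<xi> :: "nat \<Rightarrow> 'w \<Rightarrow> (nat \<Rightarrow> real^'d) \<times> (nat \<Rightarrow> real^'d)"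
    and \<theta>0 :: "real^'p"
  assumes indep: "indep_vars (\<lambda>_. batch_law B \<mu> \<nu>) \<xi> UNIV"
    and law: "\<And>j. distr M (batch_law B \<mu> \<nu>) (\<xi> j) = batch_law B \<mu> \<nu>"
    and \<alpha>_pos: "\<And>j. 0 < \<alpha> j"
begin

abbreviation \<Theta> :: "nat \<Rightarrow> 'w \<Rightarrow> real^'p" where
  "\<Theta> \<equiv> sgd g ytil B \<alpha> \<xi> \<theta>0"

abbreviation step :: "nat \<Rightarrow> 'w \<Rightarrow> real^'p" where
  "step j \<omega> \<equiv> stoch_grad g ytil B (\<xi> j \<omega>) (\<Theta> j \<omega>)"

section \<open>Independence of the iterate and the fresh batch\<close>

lemma measurable_batch [measurable]: "\<xi> j \<in> measurable M Q"
  using indep by (auto simp: indep_vars_def)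

text \<open>Requiring only the batches before \<open>j\<close>, on an arbitrary space, makes this
  apply both to the random run on \<open>M\<close> and to the coordinate maps on the finite product
  of the first \<open>j\<close> batches.\<close>

lemma measurable_sgd:
  assumes "\<And>i. i < j \<Longrightarrow> X i \<in> measurable N Q"
  shows "sgd g ytil B \<alpha> X \<theta>0 j \<in> borel_measurable N"
  using assms
proof (induction j)
  case (Suc j)
  then have [measurable]: "sgd g ytil B \<alpha> X \<theta>0 j \<in> borel_measurable N" "X j \<in> measurable N Q"
    by auto
  show ?case unfolding sgd.simps by measurable
qed simp

lemma measurable_iterate [measurable]: "\<Theta> j \<in> borel_measurable M"
  by (rule measurable_sgd) measurable

lemma sgd_restrict:
  "j \<le> n \<Longrightarrow> sgd g ytil B \<alpha> (\<lambda>i f. f i) \<theta>0 j (restrict (\<lambda>i. \<xi> i \<omega>) {..<n}) = \<Theta> j \<omega>"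
  by (induction j) auto

text \<open>The iterate \<open>\<Theta> j\<close> is a measurable function of the batches with index
  below \<open>j\<close>, hence independent of batch \<open>j\<close>. The index blocks
  \<open>{..<j}\<close> and \<open>{j}\<close> are disjoint, so their restrictions are independent,
  and the product law is pushed forward along \<open>?H\<close> and evaluation at
  \<open>j\<close>.\<close>

lemma distr_iterate_batch:
  "distr M (borel \<Otimes>\<^sub>M Q) (\<lambda>\<omega>. (\<Theta> j \<omega>, \<xi> j \<omega>)) = distr M borel (\<Theta> j) \<Otimes>\<^sub>M Q"
proof -
  let ?H = "sgd g ytil B \<alpha> (\<lambda>i f. f i) \<theta>0 j"
  let ?A = "PiM {..<j} (\<lambda>_. Q)" and ?X = "\<lambda>\<omega>. restrict (\<lambda>i. \<xi> i \<omega>) {..<j}"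
  let ?B = "PiM {j} (\<lambda>_. Q)" and ?Y = "\<lambda>\<omega>. restrict (\<lambda>i. \<xi> i \<omega>) {j}"
  have X [measurable]: "?X \<in> measurable M ?A" and Y [measurable]: "?Y \<in> measurable M ?B"
    by measurable
  have H [measurable]: "?H \<in> measurable ?A borel"
    by (rule measurable_sgd) simp
  have last [measurable]: "(\<lambda>f. f j) \<in> measurable ?B Q" by simp
  have \<Theta>: "distr (distr M ?A ?X) borel ?H = distr M borel (\<Theta> j)"
    by (subst distr_distr) (auto simp: comp_def sgd_restrict)
  have \<xi>: "distr (distr M ?B ?Y) Q (\<lambda>f. f j) = Q"
    using law[of j] by (subst distr_distr) (auto simp: comp_def)
  have "indep_var ?A ?X ?B ?Y"
    by (rule indep_var_restrict[OF indep]) auto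
  then have joint: "distr M ?A ?X \<Otimes>\<^sub>M distr M ?B ?Y = distr M (?A \<Otimes>\<^sub>M ?B) (\<lambda>\<omega>. (?X \<omega>, ?Y \<omega>))"
    by (simp add: indep_var_distribution_eq)
  have "distr (distr M ?A ?X) borel ?H \<Otimes>\<^sub>M distr (distr M ?B ?Y) Q (\<lambda>f. f j)
      = distr (distr M ?A ?X \<Otimes>\<^sub>M distr M ?B ?Y) (borel \<Otimes>\<^sub>M Q) (\<lambda>(x, y). (?H x, y j))"
    by (rule pair_measure_distr) (auto simp: \<xi> intro: Q.sigma_finite_measure)
  also have "\<dots> = distr M (borel \<Otimes>\<^sub>M Q) (\<lambda>\<omega>. (\<Theta> j \<omega>, \<xi> j \<omega>))"
    unfolding joint by (subst distr_distr) (auto simp: comp_def sgd_restrict)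
  finally show ?thesis unfolding \<Theta> \<xi> ..
qed

text \<open>These are the estimates for the product law with \<open>P\<close> the law of
  \<open>\<Theta> j\<close>, pulled back to \<open>M\<close> along the pair of iterate and
  batch.\<close>

lemma
  shows integrable_step_square: "integrable M (\<lambda>\<omega>. (norm (step j \<omega>))\<^sup>2)"
    and expectation_step_square_le: "(\<integral>\<omega>. (norm (step j \<omega>))\<^sup>2 \<partial>M) \<le> 2 * (Mx + Mz)"
    and integrable_inner_step: "integrable M (\<lambda>\<omega>. inner (G (\<Theta> j \<omega>)) (step j \<omega>))"
    and expectation_inner_step_ge:
      "(1 - V) * (\<integral>\<omega>. (norm (G (\<Theta> j \<omega>)))\<^sup>2 \<partial>M) \<le> (\<integral>\<omega>. inner (G (\<Theta> j \<omega>)) (step j \<omega>) \<partial>M)"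
proof -
  let ?P = "distr M borel (\<Theta> j)"
  have P: "prob_space ?P" "sets ?P = sets borel"
    by (auto intro: prob_space_distr)
  have pair [measurable]: "(\<lambda>\<omega>. (\<Theta> j \<omega>, \<xi> j \<omega>)) \<in> measurable M (borel \<Otimes>\<^sub>M Q)" by measurable
  have sq [measurable]: "(\<lambda>p. (norm (stoch_grad g ytil B (snd p) (fst p)))\<^sup>2) \<in> borel_measurable (borel \<Otimes>\<^sub>M Q)"
    and inn [measurable]: "(\<lambda>p. inner (G (fst p)) (stoch_grad g ytil B (snd p) (fst p)))
      \<in> borel_measurable (borel \<Otimes>\<^sub>M Q)"
    by measurable
  show "integrable M (\<lambda>\<omega>. (norm (step j \<omega>))\<^sup>2)"
    using integrable_pair_stoch_grad_square[OF P]
    unfolding distr_iterate_batch[symmetric] integrable_distr_eq[OF pair sq] by simp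
  show "(\<integral>\<omega>. (norm (step j \<omega>))\<^sup>2 \<partial>M) \<le> 2 * (Mx + Mz)"
    using expectation_pair_stoch_grad_square_le[OF P]
    unfolding distr_iterate_batch[symmetric] integral_distr[OF pair sq] by simp
  show "integrable M (\<lambda>\<omega>. inner (G (\<Theta> j \<omega>)) (step j \<omega>))"
    using integrable_pair_inner[OF P]
    unfolding distr_iterate_batch[symmetric] integrable_distr_eq[OF pair inn] by simp
  have "(\<integral>\<theta>. (norm (G \<theta>))\<^sup>2 \<partial>?P) = (\<integral>\<omega>. (norm (G (\<Theta> j \<omega>)))\<^sup>2 \<partial>M)"
    by (rule integral_distr) measurable
  then show "(1 - V) * (\<integral>\<omega>. (norm (G (\<Theta> j \<omega>)))\<^sup>2 \<partial>M) \<le> (\<integral>\<omega>. inner (G (\<Theta> j \<omega>)) (step j \<omega>) \<partial>M)"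
    using expectation_pair_inner_ge[OF P]
    unfolding distr_iterate_batch[symmetric] integral_distr[OF pair inn] by simp
qed

lemma integrable_iterate_square: "integrable M (\<lambda>\<omega>. (norm (\<Theta> j \<omega>))\<^sup>2)"
proof (induction j)
  case (Suc j)
  show ?case
  proof (rule integrable_dominated)
    let ?b = "\<lambda>\<omega>. 2 * (norm (\<Theta> j \<omega>))\<^sup>2 + 2 * ((\<alpha> j)\<^sup>2 * (norm (step j \<omega>))\<^sup>2)"
    show "integrable M ?b" using Suc integrable_step_square by simp
    show "\<bar>(norm (\<Theta> (Suc j) \<omega>))\<^sup>2\<bar> \<le> ?b \<omega>" for \<omega>
      using norm_diff_square_le[of "\<Theta> j \<omega>" "\<alpha> j *\<^sub>R step j \<omega>"] by (simp add: power_mult_distrib)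
  qed measurable
qed simp

section \<open>Expected descent and summation\<close>

abbreviation K :: real where "K \<equiv> 2 * Lth + Lth * Ly"

lemma K_nonneg: "0 \<le> K"
  using Lth_nonneg Ly_nonneg by simp

text \<open>Expansion of the loss around 0 shows at most quadratic growth, and the iterates have
  finite second moments.\<close>

lemma integrable_loss: "integrable M (\<lambda>\<omega>. loss \<mu> \<nu> g (\<Theta> j \<omega>))"
proof (rule integrable_dominated)
  let ?b = "\<lambda>\<omega>. \<bar>loss \<mu> \<nu> g 0\<bar> + norm (\<Theta> j \<omega>) * norm (G 0) + K * (norm (\<Theta> j \<omega>))\<^sup>2"
  have "integrable M (\<lambda>\<omega>. norm (\<Theta> j \<omega>))"
    by (intro integrable_norm, rule integrable_if_square_integrable) (auto simp: integrable_iterate_square)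
  then show "integrable M ?b"
    using integrable_iterate_square by simp
  show "\<bar>loss \<mu> \<nu> g (\<Theta> j \<omega>)\<bar> \<le> ?b \<omega>" for \<omega>
    using loss_expansion[of 0 "\<Theta> j \<omega>"] Cauchy_Schwarz_ineq2[of "\<Theta> j \<omega>" "G 0"] by simp
qed measurable

text \<open>The expansion of the loss is applied along the actual step. In expectation its linear
  part gains at least \<open>1 - V\<close> times the mean squared gradient, and its quadratic part
  is controlled by the second moment of the step.\<close>

lemma expected_descent:
  "(\<integral>\<omega>. loss \<mu> \<nu> g (\<Theta> (Suc j) \<omega>) \<partial>M)
    \<le> (\<integral>\<omega>. loss \<mu> \<nu> g (\<Theta> j \<omega>) \<partial>M) - \<alpha> j * ((1 - V) * (\<integral>\<omega>. (norm (G (\<Theta> j \<omega>)))\<^sup>2 \<partial>M))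
      + K * (2 * (Mx + Mz)) * (\<alpha> j)\<^sup>2"
proof -
  let ?b = "\<lambda>\<omega>. loss \<mu> \<nu> g (\<Theta> j \<omega>) - \<alpha> j * inner (G (\<Theta> j \<omega>)) (step j \<omega>)
    + K * (\<alpha> j)\<^sup>2 * (norm (step j \<omega>))\<^sup>2"
  have "(\<integral>\<omega>. loss \<mu> \<nu> g (\<Theta> (Suc j) \<omega>) \<partial>M) \<le> (\<integral>\<omega>. ?b \<omega> \<partial>M)"
  proof (rule integral_mono)
    show "integrable M ?b"
      using integrable_loss[of j] integrable_inner_step[of j] integrable_step_square[of j] by simp
    show "loss \<mu> \<nu> g (\<Theta> (Suc j) \<omega>) \<le> ?b \<omega>" for \<omega>
      using loss_expansion[of "\<Theta> j \<omega>" "- (\<alpha> j *\<^sub>R step j \<omega>)"]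
      by (simp add: abs_le_iff inner_commute power_mult_distrib mult.assoc)
  qed (rule integrable_loss)
  also have "\<dots> = (\<integral>\<omega>. loss \<mu> \<nu> g (\<Theta> j \<omega>) \<partial>M) - \<alpha> j * (\<integral>\<omega>. inner (G (\<Theta> j \<omega>)) (step j \<omega>) \<partial>M)
      + K * (\<alpha> j)\<^sup>2 * (\<integral>\<omega>. (norm (step j \<omega>))\<^sup>2 \<partial>M)"
    using integrable_loss[of j] integrable_inner_step[of j] integrable_step_square[of j] by simp
  also have "\<dots> \<le> (\<integral>\<omega>. loss \<mu> \<nu> g (\<Theta> j \<omega>) \<partial>M)
      - \<alpha> j * ((1 - V) * (\<integral>\<omega>. (norm (G (\<Theta> j \<omega>)))\<^sup>2 \<partial>M)) + K * (\<alpha> j)\<^sup>2 * (2 * (Mx + Mz))"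
    using \<alpha>_pos[of j] K_nonneg expectation_inner_step_ge[of j] expectation_step_square_le[of j]
    by (intro add_mono diff_mono mult_left_mono) auto
  finally show ?thesis by (simp add: mult_ac)
qed

lemma liminf_expected_gradient:
  assumes "V < 1" and divergent: "filterlim (\<lambda>n. \<Sum>j<n. \<alpha> j) at_top sequentially"
    and summable: "summable (\<lambda>j. (\<alpha> j)\<^sup>2)"
  shows "liminf (\<lambda>j. ereal (\<integral>\<omega>. (norm (G (\<Theta> j \<omega>)))\<^sup>2 \<partial>M)) = 0"
proof -
  define a where "a j = (\<integral>\<omega>. (norm (G (\<Theta> j \<omega>)))\<^sup>2 \<partial>M)" for j
  define m where "m = (\<integral>x. (norm x)\<^sup>2 \<partial>\<mu>) + (\<integral>z. (norm z)\<^sup>2 \<partial>\<nu>)"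
  define D where "D = K * (2 * (Mx + Mz))"
  have D: "0 \<le> D" using K_nonneg Mx_pos Mz_pos by (simp add: D_def)
  have telescoped: "(1 - V) * (\<Sum>j<n. \<alpha> j * a j)
      \<le> loss \<mu> \<nu> g \<theta>0 - (\<integral>\<omega>. loss \<mu> \<nu> g (\<Theta> n \<omega>) \<partial>M) + D * (\<Sum>j<n. (\<alpha> j)\<^sup>2)" for n
  proof (induction n)
    case 0
    show ?case by (simp add: prob_space)
  next
    case (Suc n)
    then show ?case
      using expected_descent[of n] unfolding a_def[symmetric] D_def[symmetric]
      by (simp add: algebra_simps)
  qed
  \<comment> \<open>This bound is independent of \<open>n\<close>: the expected loss is at least
    \<open>- m\<close> wherever the iterates go, and the quadratic errors are summable.\<close>
  have "(\<Sum>j<n. \<alpha> j * a j) \<le> (loss \<mu> \<nu> g \<theta>0 + m + D * (\<Sum>j. (\<alpha> j)\<^sup>2)) / (1 - V)" for n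
  proof -
    have "- m \<le> (\<integral>\<omega>. loss \<mu> \<nu> g (\<Theta> n \<omega>) \<partial>M)"
      unfolding m_def by (rule integral_ge_const[OF integrable_loss AE_I2]) (rule loss_bounded_below)
    moreover have "D * (\<Sum>j<n. (\<alpha> j)\<^sup>2) \<le> D * (\<Sum>j. (\<alpha> j)\<^sup>2)"
      using D summable by (intro mult_left_mono sum_le_suminf) auto
    ultimately have "(1 - V) * (\<Sum>j<n. \<alpha> j * a j) \<le> loss \<mu> \<nu> g \<theta>0 + m + D * (\<Sum>j. (\<alpha> j)\<^sup>2)"
      using telescoped[of n] by linarith
    then show ?thesis using assms(1) by (simp add: pos_le_divide_eq mult.commute)
  qed
  then show ?thesis
    using \<alpha>_pos divergent unfolding a_def[symmetric]
    by (intro liminf_eq_0_if_weighted_sums_bounded[of a \<alpha>]) (auto simp: a_def less_imp_le)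
qed

end

theorem theorem3p10:
  fixes \<mu> \<nu> :: "(real^'d) measure"
    and g :: "real^'p \<Rightarrow> real^'d \<Rightarrow> real"
    and ytil :: "real^'p \<Rightarrow> real^'d \<Rightarrow> real^'d"
    and Linf Lth Ly eps_p Mx Mz Mt M_L U V :: real
    and S :: "(real^'p) set"
    and eps :: "real^'p \<Rightarrow> real"
    and \<alpha> :: "nat \<Rightarrow> real"
    and B :: nat
    and M :: "'w measure"
    and \<xi> :: "nat \<Rightarrow> 'w \<Rightarrow> (nat \<Rightarrow> real^'d) \<times> (nat \<Rightarrow> real^'d)"
    and \<theta>0 :: "real^'p"
  assumes "prob_space \<mu>" and "sets \<mu> = sets borel"
    and "prob_space \<nu>" and "sets \<nu> = sets borel"
    and "integrable \<mu> (\<lambda>x. (norm x)\<^sup>2)"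
    and "integrable \<nu> (\<lambda>z. (norm z)\<^sup>2)"
    and "\<And>\<theta>. convex_on UNIV (g \<theta>)"
    and "C1 (\<lambda>(\<theta>, y). g \<theta> y)"
    and "Lth-lipschitz_on UNIV (\<lambda>(\<theta>, y). grad_param g \<theta> y)"
    and "Ly-lipschitz_on UNIV (\<lambda>(\<theta>, y). grad_point g \<theta> y)"
    and "second_param_partials_exist g"
    and "open S" and "S \<noteq> {}" and "\<And>\<theta>. \<theta> \<in> S \<Longrightarrow> Linf \<le> loss \<mu> \<nu> g \<theta>"
    and "(\<lambda>(\<theta>, z). ytil \<theta> z) \<in> borel_measurable borel"
    and "eps_p > 0"
    and "\<And>\<theta> z. norm ((ytil \<theta> z - z) + grad_point g \<theta> (ytil \<theta> z)) < eps_p"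
    and "Mx > 0" and "Mz > 0"
    and "\<And>\<theta>. (\<integral>x. (norm (grad_param g \<theta> x))\<^sup>2 \<partial>\<mu>) < Mx"
    and "\<And>\<theta>. (\<integral>z. (norm (grad_param g \<theta> (ytil \<theta> z)))\<^sup>2 \<partial>\<nu>) < Mz"
    and "\<And>\<theta>. (\<integral>z. (norm (grad_param g \<theta> (exact_min g \<theta> z)))\<^sup>2 \<partial>\<nu>) < Mz"
    and "Mt = Mx + Mz + 2 * sqrt (Mx * Mz)"
    and "M_L > 0"
    and "\<And>\<theta>. (norm (grad (loss \<mu> \<nu> g) \<theta>))\<^sup>2 \<le> M_L"
    and "0 < V" and "V < 1" and "U = 1 - V"
    and "\<And>\<theta> z. norm (ytil \<theta> z - exact_min g \<theta> z) < eps \<theta>"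
    and "\<And>\<theta>. eps \<theta> \<le> V * (norm (grad (loss \<mu> \<nu> g) \<theta>))\<^sup>2 / (Lth * (sqrt Mx + sqrt Mz))"
    and "\<And>j. \<alpha> j > 0"
    and "decseq \<alpha>"
    and "filterlim (\<lambda>n. \<Sum>j<n. \<alpha> j) at_top sequentially"
    and "summable (\<lambda>j. (\<alpha> j)\<^sup>2)"
    and "\<alpha> 0 \<le> U * M_L / (Lth * Mt)"
    and "B \<ge> 1"
    and "prob_space M"
    and "prob_space.indep_vars M (\<lambda>_. batch_law B \<mu> \<nu>) \<xi> UNIV"
    and "\<And>j. distr M (batch_law B \<mu> \<nu>) (\<xi> j) = batch_law B \<mu> \<nu>"
  shows "liminf (\<lambda>j. ereal (\<integral>\<omega>. (norm (grad (loss \<mu> \<nu> g) (sgd g ytil B \<alpha> \<xi> \<theta>0 j \<omega>)))\<^sup>2 \<partial>M)) = 0"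
proof -
  \<comment> \<open>This interpretation comes first because it supplies \<open>grad_loss\<close>,
    which turns the hypothesis on \<open>grad (loss \<mu> \<nu> g)\<close> into the one on
    \<open>G\<close> that the second interpretation requires.\<close>
  interpret lipschitz_dual_loss g Lth Ly \<mu> \<nu>
    using assms(1-10)
    by (intro lipschitz_dual_loss.intro lipschitz_potential.intro lipschitz_dual_loss_axioms.intro)
  interpret sgd_run g Lth Ly \<mu> \<nu> ytil Mx Mz V eps B M \<alpha> \<xi> \<theta>0
    using assms(15,18-22,26,27,29-31,36-39)
    by (intro sgd_run.intro approximate_dual_loss.intro approximate_dual_loss_axioms.intro
        sgd_run_axioms.intro lipschitz_dual_loss_axioms) (simp_all add: grad_loss)
  show ?thesis
    using liminf_expected_gradient assms(27,33,34) by (simp add: grad_loss)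
qed

end
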